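(* Let $A(z)$ be an exponential polynomial of order $n\ge1$, let $\theta^*\in\mathbb{R}$ be such that $h_A(\theta^* )=\max_\theta h_A(\theta)$, and let $\varepsilon\in(0,\pi/(2n))$. Let $\{f_1,f_2\}$ be a solution base (a pair of linearly independent solutions) of $f''+A(z)f=0$, and let $f_3$ be any linear combination of $f_1,f_2$ that is not of the form $cf_j$ with $c\in\mathbb{C}$, $j\in\{1,2\}$. Then $$\max_{j=1,2,3}\{\lambda_2(S(\theta^*,\varepsilon),f_j)\}=n,$$ where $S(\theta^*,\varepsilon)=\{z\in\mathbb{C}:|\arg(z)-\theta^*|<\varepsilon\}$ and $\lambda_2(S(\theta^*,\varepsilon),f_j)$ is the hyper-exponent of convergence of the zeros of $f_j$ in the sector $S(\theta^*,\varepsilon)$.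
   Context: An exponential polynomial is an entire function of the form $P_1(z)e^{Q_1(z)}+\cdots+P_k(z)e^{Q_k(z)}$ with $P_j,Q_j$ polynomials. The Phragmén–Lindelöf indicator of an entire function $A$ of order $n>0$ is $h_A(\theta)=\limsup_{r\to\infty}r^{-n}\log|A(re^{i\theta})|$. The hyper-exponent of convergence of the zeros of $f$ in a sector $S$ is $\lambda_2(S,f)=\limsup_{r\to\infty}\frac{\log^+\log^+ n_S(r)}{\log r}$, where $n_S(r)$ is the number of zeros of $f$ in $S\cap\{|z|\le r\}$, counted with multiplicity. *)

theory Defs
  imports "HOL-Complex_Analysis.Complex_Analysis" "HOL-Computational_Algebra.Polynomial"
begin

definition exponential_polynomial :: "(complex \<Rightarrow> complex) \<Rightarrow> bool" where
  "exponential_polynomial A \<longleftrightarrow>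
     (\<exists>(k::nat) (P :: nat \<Rightarrow> complex poly) (Q :: nat \<Rightarrow> complex poly).
        A = (\<lambda>z. \<Sum>j<k. poly (P j) z * exp (poly (Q j) z)))"

text \<open>Only applied to arguments \<open>x \<ge> 0\<close>; the value at \<open>0\<close> is \<open>0\<close>.\<close>

definition log_plus :: "real \<Rightarrow> real" where
  "log_plus x = (if x \<le> 1 then 0 else ln x)"

definition max_modulus :: "(complex \<Rightarrow> complex) \<Rightarrow> real \<Rightarrow> real" where
  "max_modulus f r = (SUP z\<in>sphere 0 r. cmod (f z))"

definition growth_order :: "(complex \<Rightarrow> complex) \<Rightarrow> ereal" where
  "growth_order f =
     Limsup at_top (\<lambda>r::real. ereal (log_plus (log_plus (max_modulus f r)) / ln r))"

text \<open>Extended-valued logarithm: the library has \<open>ln 0 = 0\<close> on the reals, whereas the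
  indicator needs \<open>log 0 = -\<infinity>\<close> at zeros lying on the ray.\<close>

definition log_ext :: "real \<Rightarrow> ereal" where
  "log_ext x = (if x \<le> 0 then -\<infinity> else ereal (ln x))"

text \<open>The parameter \<open>n\<close> is meant to be the order of \<open>A\<close>.\<close>

definition PL_indicator :: "nat \<Rightarrow> (complex \<Rightarrow> complex) \<Rightarrow> real \<Rightarrow> ereal" where
  "PL_indicator n A \<theta> =
     Limsup at_top (\<lambda>r::real. ereal (1 / r ^ n) * log_ext (cmod (A (of_real r * cis \<theta>))))"

text \<open>Since \<open>\<theta>\<close> is an arbitrary real, \<open>arg z\<close> ranges over all values of the argument, not just
  the principal one. The apex \<open>0\<close>, which has no argument, is excluded.\<close>

definition sector :: "real \<Rightarrow> real \<Rightarrow> complex set" where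
  "sector \<theta> \<epsilon> = {z. z \<noteq> 0 \<and> (\<exists>\<phi>. is_Arg z \<phi> \<and> \<bar>\<phi> - \<theta>\<bar> < \<epsilon>)}"

definition zero_count :: "complex set \<Rightarrow> (complex \<Rightarrow> complex) \<Rightarrow> real \<Rightarrow> nat" where
  "zero_count S f r = (\<Sum>z | z \<in> S \<and> cmod z \<le> r \<and> f z = 0. nat (zorder f z))"

definition hyper_exponent :: "complex set \<Rightarrow> (complex \<Rightarrow> complex) \<Rightarrow> ereal" where
  "hyper_exponent S f =
     Limsup at_top (\<lambda>r::real. ereal (log_plus (log_plus (real (zero_count S f r))) / ln r))"

definition ode_solution :: "(complex \<Rightarrow> complex) \<Rightarrow> (complex \<Rightarrow> complex) \<Rightarrow> bool" where
  "ode_solution A f \<longleftrightarrow> f holomorphic_on UNIV \<and> (\<forall>z. deriv (deriv f) z + A z * f z = 0)"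

definition lin_indep_pair :: "(complex \<Rightarrow> complex) \<Rightarrow> (complex \<Rightarrow> complex) \<Rightarrow> bool" where
  "lin_indep_pair f g \<longleftrightarrow>
     (\<forall>a b :: complex. (\<forall>z. a * f z + b * g z = 0) \<longrightarrow> a = 0 \<and> b = 0)"

definition solution_base ::
  "(complex \<Rightarrow> complex) \<Rightarrow> (complex \<Rightarrow> complex) \<Rightarrow> (complex \<Rightarrow> complex) \<Rightarrow> bool" where
  "solution_base A f g \<longleftrightarrow> ode_solution A f \<and> ode_solution A g \<and> lin_indep_pair f g"

end

theory Submission
  imports Defs "HOL-Real_Asymp.Real_Asymp"
begin

text \<open>
  If \<open>\<bar>A\<bar> \<le> K\<close> near a point and \<open>K s\<^sup>2 \<le> 1/16\<close>, a nontrivial solution has simple zeros at mutual distance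
  greater than \<open>s\<close>; counting grid cells with \<open>K = exp (r\<^sup>a)\<close>, \<open>a > n\<close>, gives the upper bound \<open>n\<close>.

  For the lower bound suppose all three hyper-exponents are below \<open>\<tau> < n\<close>. A large value of
  \<open>f\<^sub>j'/f\<^sub>j\<close> forces a zero of \<open>f\<^sub>j\<close> nearby, so away from the zeros the constant Wronskians bound every
  \<open>\<bar>f\<^sub>i f\<^sub>j\<bar>\<close>, \<open>i \<noteq> j\<close>, from below. Dividing \<open>f\<^sub>1 f\<^sub>2 f\<^sub>3\<close> by the product over its
  zeros in the sector with modulus at most \<open>2R\<close>
  therefore leaves a zero-free function whose log-modulus is, up to an additive constant, a positive
  harmonic function in the sector. Harnack chains of length \<open>O(log R)\<close> bound it along the ray by
  \<open>exp (O(R\<^sup>\<tau>))\<close> times a power of \<open>R\<close>. This bounds the logarithmic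
  derivative of \<open>f\<^sub>1\<close> on circles around \<open>R e\<^sup>i\<^sup>\<theta>\<close> that stay away from the zeros, hence
  \<open>log \<bar>A\<bar> = log \<bar>f\<^sub>1''/f\<^sub>1\<bar>\<close> is \<open>o(R\<^sup>n)\<close> there, and at the centre by the maximum principle.
  But the indicator is positive at its maximum: on a generic ray a single exponential term dominates.
\<close>

section \<open>Local behaviour of solutions\<close>

text \<open>Why three solutions: two-sided bounds on f1 f2 would still allow f1 = e^g, f2 = e^(-g)
  with g huge. With a third solution, an upper bound on the triple product divided by a pairwise
  lower bound controls every single factor from above, and then every factor from below.

  Why two distances from the zeros: the Wronskian step needs a distance d of size at most about
  |A|^(-1/2), here exp(-(3R)^p)/16 with p above the order n. This is harmless, because d enters only
  through log(1/d), a power of R. The Riccati equation uses the reciprocal distance polynomially,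
  and there such a d would give nothing better than the trivial bound for A. So that step takes a
  new distance 1/(2N+1), N being the number of zeros, which costs only exp(O(R^tau)).

  Why the chain is logarithmic: discs in the sector centred on the ray at modulus t may have radius
  proportional to t, so each Harnack step multiplies the modulus by a fixed factor and the
  accumulated constant is a power of R. The final bound for A is then built from powers of R and
  exp((2R)^tau), so its logarithm is o(R^n).\<close>

lemma solution_derivs:
  assumes "ode_solution A f"
  shows "(f has_field_derivative deriv f z) (at z)"
    and "(deriv f has_field_derivative - A z * f z) (at z)"
proof -
  have hol: "f holomorphic_on UNIV" and eq: "deriv (deriv f) z + A z * f z = 0"
    using assms by (auto simp: ode_solution_def)
  show "(f has_field_derivative deriv f z) (at z)"
    using hol by (simp add: holomorphic_derivI)
  have "deriv f holomorphic_on UNIV"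
    using hol by (intro holomorphic_deriv) auto
  then have "(deriv f has_field_derivative deriv (deriv f) z) (at z)"
    by (simp add: holomorphic_derivI)
  moreover have "deriv (deriv f) z = - A z * f z"
    using eq by (simp add: eq_neg_iff_add_eq_0)
  ultimately show "(deriv f has_field_derivative - A z * f z) (at z)"
    by simp
qed

text \<open>Since f'' = -A f, the Taylor remainder is at most K m |h|^2, with m the maximum of |f|
  on the disc of radius |h|. That maximum is at most the affine part plus K m |h|^2 <= m/16, so it
  can be absorbed. On the scale K^(-1/2) a solution is thus nearly affine.\<close>

lemma solution_taylor:
  assumes sol: "ode_solution A f"
    and K: "\<And>w. w \<in> cball z s \<Longrightarrow> cmod (A w) \<le> K"
    and Ks: "K * s\<^sup>2 \<le> 1/16" and h: "cmod h \<le> s"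
  shows "cmod (f (z + h) - f z - deriv f z * h)
           \<le> 2 * K * (cmod h)\<^sup>2 * (cmod (f z) + cmod (deriv f z) * cmod h)"
proof -
  define r where "r = cmod h"
  have r: "0 \<le> r" "r \<le> s" using h by (auto simp: r_def)
  have hol: "f holomorphic_on UNIV" using sol by (simp add: ode_solution_def)
  have K0: "0 \<le> K" using K[of z] r by (smt (verit) centre_in_cball norm_ge_zero)
  have "continuous_on (cball z r) (\<lambda>w. cmod (f w))"
    using hol by (intro continuous_intros holomorphic_on_imp_continuous_on) (auto intro: holomorphic_on_subset)
  moreover have "compact (cball z r)" "cball z r \<noteq> {}" using r by auto
  ultimately obtain w0 where w0: "w0 \<in> cball z r" "\<And>w. w \<in> cball z r \<Longrightarrow> cmod (f w) \<le> cmod (f w0)"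
    using continuous_attains_sup[of "cball z r" "\<lambda>w. cmod (f w)"] by blast
  define m where "m = cmod (f w0)"
  define F where "F = (\<lambda>i::nat. if i = 0 then f else if i = 1 then deriv f else (\<lambda>z. - A z * f z))"
  have T: "cmod (f w - f z - deriv f z * (w - z)) \<le> K * m * (cmod (w - z))\<^sup>2"
    if "w \<in> cball z r" for w
  proof -
    have "cmod (F 0 w - (\<Sum>i\<le>1. F i z * (w-z) ^ i / (fact i))) \<le> (K * m) * cmod(w - z)^(Suc 1) / fact 1"
    proof (rule complex_Taylor[of "cball z r"])
      show "(F i has_field_derivative F (Suc i) x) (at x within cball z r)" if "i \<le> 1" for i x
        using that solution_derivs[OF sol, of x]
        by (auto simp: F_def le_Suc_eq intro: has_field_derivative_at_within)
      show "cmod (F (Suc 1) x) \<le> K * m" if "x \<in> cball z r" for x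
        using that w0(2)[OF that] K[of x] r K0
        by (auto simp: F_def norm_mult m_def intro!: mult_mono)
    qed (use that r in auto)
    then show ?thesis by (simp add: F_def power2_eq_square diff_diff_eq)
  qed
  have m0: "0 \<le> m" by (simp add: m_def)
  have Kr: "K * r\<^sup>2 \<le> 1/16"
    using Ks K0 r by (smt (verit) mult_left_mono power_mono)
  define B where "B = cmod (f z) + cmod (deriv f z) * r"
  have "m \<le> B + m / 16"
  proof -
    have d: "cmod (w0 - z) \<le> r" using w0(1) by (simp add: dist_norm norm_minus_commute)
    have "m = cmod ((f w0 - f z - deriv f z * (w0 - z)) + f z + deriv f z * (w0 - z))"
      by (simp add: m_def)
    also have "\<dots> \<le> K * m * (cmod (w0 - z))\<^sup>2 + cmod (f z) + cmod (deriv f z) * cmod (w0 - z)"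
      using T[OF w0(1)] by (metis (no_types, lifting) add_mono_thms_linordered_semiring(1) norm_add_leD norm_mult norm_triangle_mono order_refl)
    also have "\<dots> \<le> K * m * r\<^sup>2 + cmod (f z) + cmod (deriv f z) * r"
      using d K0 m0 r by (intro add_mono mult_left_mono power_mono) auto
    also have "K * m * r\<^sup>2 \<le> m / 16"
      using mult_left_mono[OF Kr m0] by (simp add: mult_ac)
    finally show ?thesis by (simp add: B_def)
  qed
  then have mB: "m \<le> 2 * B" using m0 by simp
  have "cmod (f (z + h) - f z - deriv f z * h) \<le> K * m * r\<^sup>2"
    using T[of "z + h"] by (simp add: r_def dist_norm)
  also have "\<dots> \<le> K * (2 * B) * r\<^sup>2"
    using mB K0 by (intro mult_right_mono mult_left_mono) auto
  finally show ?thesis by (simp add: B_def r_def algebra_simps)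
qed

text \<open>Uniqueness for the initial value problem: with zero data the right-hand side of
  \<open>solution_taylor\<close> is 0, so \<open>f\<close> vanishes on a small disc, and the
  identity theorem does the rest.\<close>

lemma solution_zero_data_imp_zero:
  assumes sol: "ode_solution A f" and A: "continuous_on UNIV A"
    and fa: "f a = 0" "deriv f a = 0"
  shows "f z = 0"
proof -
  have "compact (A ` cball a 1)"
    by (intro compact_continuous_image continuous_on_subset[OF A]) auto
  then obtain K where K: "K > 0" "\<And>w. w \<in> cball a 1 \<Longrightarrow> cmod (A w) \<le> K"
    using compact_imp_bounded bounded_pos by (metis image_eqI)
  define s where "s = min 1 (1 / (4 * sqrt K))"
  have s: "s > 0" "s \<le> 1" using K by (auto simp: s_def)
  have "s\<^sup>2 \<le> (1 / (4 * sqrt K))\<^sup>2" using s by (intro power_mono) (auto simp: s_def)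
  then have "K * s\<^sup>2 \<le> 1/16"
    using K by (simp add: power_divide power_mult_distrib field_simps)
  then have "f (a + h) = 0" if "cmod h \<le> s" for h
    using solution_taylor[OF sol, of a s K h] K(2) s that fa by auto
  then have "f w = 0" if "w \<in> ball a s" for w
    using that by (metis add.commute diff_add_cancel dist_commute dist_norm less_eq_real_def mem_ball)
  then show ?thesis
    using analytic_continuation_open[of "ball a s" UNIV f "\<lambda>_. 0" z] s sol
    by (auto simp: ode_solution_def)
qed

text \<open>If \<open>a\<close> and \<open>a + h\<close> are both zeros, the affine part f'(a) h is
  itself the Taylor error, which is at most 1/8 of |f'(a) h|. Nontriviality enters through f'(a)
  being nonzero.\<close>

lemma solution_zeros_separated:
  assumes sol: "ode_solution A f" and A: "continuous_on UNIV A"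
    and nz: "f z0 \<noteq> 0"
    and K: "\<And>w. w \<in> cball a s \<Longrightarrow> cmod (A w) \<le> K"
    and Ks: "K * s\<^sup>2 \<le> 1/16"
    and ab: "f a = 0" "f b = 0" "cmod (b - a) \<le> s"
  shows "a = b"
proof (rule ccontr)
  assume "a \<noteq> b"
  define h where "h = b - a"
  have h: "cmod h > 0" "cmod h \<le> s" "b = a + h" using \<open>a \<noteq> b\<close> ab by (auto simp: h_def)
  have d: "deriv f a \<noteq> 0"
    using solution_zero_data_imp_zero[OF sol A ab(1)] nz by blast
  have K0: "K \<ge> 0" using K[of a] h by (smt (verit) centre_in_cball norm_ge_zero)
  have Kr: "K * (cmod h)\<^sup>2 \<le> 1/16"
    using Ks K0 h by (smt (verit) mult_left_mono power_mono)
  have "cmod (deriv f a * h) \<le> 2 * K * (cmod h)\<^sup>2 * (cmod (deriv f a) * cmod h)"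
    using solution_taylor[of A f a s K h] sol K Ks h ab by simp
  also have "\<dots> = 2 * (K * (cmod h)\<^sup>2) * cmod (deriv f a * h)"
    by (simp add: norm_mult)
  also have "\<dots> \<le> 2 * (1/16) * cmod (deriv f a * h)"
    using Kr by (intro mult_right_mono) auto
  finally have "cmod (deriv f a * h) \<le> 0" by simp
  then show False using d h by simp
qed

section \<open>Maximum and minimum modulus on discs\<close>

lemma norm_le_on_disc:
  assumes "G holomorphic_on cball z s" "s > 0" "\<And>w. cmod (w - z) = s \<Longrightarrow> cmod (G w) \<le> M" "w \<in> cball z s"
  shows "cmod (G w) \<le> M"
proof (rule maximum_modulus_frontier[of G "cball z s"])
  show "G holomorphic_on interior (cball z s)"
    using assms(1) by (rule holomorphic_on_subset) auto
  show "continuous_on (closure (cball z s)) G"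
    using assms(1) by (simp add: holomorphic_on_imp_continuous_on)
  show "cmod (G w) \<le> M" if "w \<in> frontier (cball z s)" for w
    using that assms by (simp add: dist_norm norm_minus_commute)
qed (use assms in auto)

lemma norm_ge_on_disc:
  assumes "G holomorphic_on cball z s" "s > 0" "\<And>w. w \<in> cball z s \<Longrightarrow> G w \<noteq> 0"
    "\<And>w. cmod (w - z) = s \<Longrightarrow> cmod (G w) \<ge> m" "m > 0" "w \<in> cball z s"
  shows "cmod (G w) \<ge> m"
proof -
  have "cmod (1 / G w) \<le> 1 / m"
  proof (rule norm_le_on_disc[of "\<lambda>w. 1 / G w" z s])
    show "(\<lambda>w. 1 / G w) holomorphic_on cball z s"
      using assms by (intro holomorphic_intros) auto
    show "cmod (1 / G w) \<le> 1 / m" if "cmod (w - z) = s" for w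
      using assms(4)[OF that] \<open>m > 0\<close> by (simp add: norm_divide frac_le)
  qed (use assms in auto)
  then show ?thesis
    using assms(3)[OF assms(6)] \<open>m > 0\<close> by (simp add: norm_divide field_simps)
qed

text \<open>If v = f'/f were larger than 2/s, the affine approximation f(z)(1 + v h) would vanish at
  \<open>h0 = - 1 / v\<close>, well inside the zero-free disc. On the circle of radius 1/|v| about
  \<open>z + h0\<close> one has |1 + v h| = 1, so |f| is comparable to |f(z)|, while at the centre
  it is small. This contradicts the minimum modulus principle.\<close>

lemma solution_log_deriv_bound:
  assumes sol: "ode_solution A f" and s: "s > 0"
    and K: "\<And>w. w \<in> cball z s \<Longrightarrow> cmod (A w) \<le> K" and Ks: "K * s\<^sup>2 \<le> 1/16"
    and nz: "\<And>w. cmod (w - z) < s \<Longrightarrow> f w \<noteq> 0"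
  shows "s * cmod (deriv f z) \<le> 2 * cmod (f z)"
proof (rule ccontr)
  assume *: "\<not> ?thesis"
  have fz: "f z \<noteq> 0" using nz[of z] s by simp
  define v where "v = deriv f z / f z"
  have dv: "deriv f z = f z * v" using fz by (simp add: v_def)
  define r where "r = 1 / cmod v"
  have sv: "s * cmod v > 2"
    using * fz by (simp add: v_def norm_divide field_simps)
  then have v: "cmod v > 0" using s by (metis mult_zero_right norm_ge_zero not_less_iff_gr_or_eq less_eq_real_def zero_less_numeral order_less_trans)
  have r: "r > 0" "2 * r < s" "r * cmod v = 1" using v sv by (auto simp: r_def field_simps)
  define h0 where "h0 = - 1 / v"
  have h0: "cmod h0 = r" "1 + v * h0 = 0" using v by (auto simp: h0_def r_def norm_divide)
  have K0: "0 \<le> K" using K[of z] s by (smt (verit) centre_in_cball norm_ge_zero)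
  have "(2*r)\<^sup>2 \<le> s\<^sup>2" using r by (intro power_mono) auto
  then have Kr: "K * r\<^sup>2 \<le> 1/64"
    using Ks mult_left_mono[of "4 * r\<^sup>2" "s\<^sup>2" K] K0 by (simp add: power_mult_distrib)
  have hol: "f holomorphic_on UNIV" using sol by (simp add: ode_solution_def)
  have err: "cmod (f (z + h) - f z * (1 + v * h)) \<le> 2 * K * (cmod h)\<^sup>2 * (cmod (f z) * (1 + cmod v * cmod h))"
    if "cmod h \<le> s" for h
    using solution_taylor[of A f z s K h] sol K Ks that by (simp add: dv algebra_simps norm_mult)
  \<comment> \<open>On the circle |h| <= 2r and K r^2 <= 1/64, so the Taylor error is at most 24 K
    r^2 |f(z)| <= 3/8 |f(z)|, which leaves 5/8. At the centre the error is only 4 K r^2 |f(z)| <=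
    1/16 |f(z)|.\<close>
  have "cmod (f (z + h0)) \<ge> cmod (f z) * (5/8)"
  proof (rule norm_ge_on_disc[of f "z + h0" r])
    have sub: "cmod (w - z) < s" if "w \<in> cball (z + h0) r" for w
      using that r h0 norm_triangle_ineq[of "w - (z + h0)" h0] by (simp add: dist_norm norm_minus_commute)
    show "f w \<noteq> 0" if "w \<in> cball (z + h0) r" for w
      using nz sub that by blast
    show "cmod (f z) * (5/8) \<le> cmod (f w)" if "cmod (w - (z + h0)) = r" for w
    proof -
      define h where "h = w - z"
      have h: "cmod h \<le> 2 * r" using that h0 norm_triangle_ineq[of "w - (z + h0)" h0] by (simp add: h_def)
      have "1 + v * h = v * (w - (z + h0))" using h0 by (simp add: h_def algebra_simps)
      then have 1: "cmod (1 + v * h) = 1" using that r by (simp add: norm_mult mult.commute)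
      have "2 * K * (cmod h)\<^sup>2 * (cmod (f z) * (1 + cmod v * cmod h)) \<le> 2 * K * (2*r)\<^sup>2 * (cmod (f z) * (1 + cmod v * (2 * r)))"
        using h K0 r by (intro mult_mono mult_left_mono power_mono add_mono) auto
      also have "\<dots> = 24 * (K * r\<^sup>2) * cmod (f z)" using r by (simp add: algebra_simps power2_eq_square)
      also have "\<dots> \<le> 3/8 * cmod (f z)"
        using mult_right_mono[OF Kr, of "cmod (f z)"] by (simp add: mult_ac)
      finally have "cmod (f w - f z * (1 + v * h)) \<le> 3/8 * cmod (f z)"
        using err[of h] h r by (simp add: h_def)
      moreover have "cmod (f z * (1 + v * h)) = cmod (f z)" using 1 by (simp add: norm_mult)
      ultimately show ?thesis
        using norm_triangle_ineq2[of "f z * (1 + v * h)" "f w"] by (simp add: norm_minus_commute)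
    qed
  qed (use hol r fz in \<open>auto intro: holomorphic_on_subset\<close>)
  moreover have "cmod (f (z + h0)) \<le> 4 * (K * r\<^sup>2) * cmod (f z)"
    using err[of h0] h0 r by (simp add: mult_ac)
  moreover have "4 * (K * r\<^sup>2) * cmod (f z) \<le> 1/16 * cmod (f z)"
    using mult_right_mono[OF Kr, of "cmod (f z)"] by (simp add: mult_ac)
  moreover have "cmod (f z) > 0" using fz by simp
  ultimately show False by linarith
qed

section \<open>Harnack estimates for zero-free functions\<close>

text \<open>Needed for the Cayley transform h -> (h - b)/(h + cnj b), which therefore maps the right
  half-plane into the unit disc.\<close>

lemma norm_diff_less_norm_add_cnj:
  assumes "Re h > 0" "Re b > 0"
  shows "cmod (h - b) < cmod (h + cnj b)"
proof -
  have "(cmod (h + cnj b))\<^sup>2 - (cmod (h - b))\<^sup>2 = 4 * Re h * Re b"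
    by (simp only: cmod_power2) (simp add: power2_eq_square algebra_simps)
  moreover have "Re h * Re b > 0" using assms by simp
  ultimately have "(cmod (h - b))\<^sup>2 < (cmod (h + cnj b))\<^sup>2" by (simp add: mult.assoc)
  then show ?thesis by (rule power_less_imp_less_base) simp
qed

text \<open>Borel-Caratheodory for the half-plane: following \<open>H\<close> by the Cayley
  transform that sends \<open>H z0\<close> to 0 gives a map of the disc into itself, and the Schwarz
  lemma bounds it by 1/2 at half the radius.\<close>

lemma caratheodory_pos:
  assumes hol: "H holomorphic_on ball z0 \<rho>" and \<rho>: "\<rho> > 0"
    and pos: "\<And>z. z \<in> ball z0 \<rho> \<Longrightarrow> Re (H z) > 0"
    and z: "cmod (z - z0) \<le> \<rho> / 2"
  shows "cmod (H z - H z0) \<le> 2 * Re (H z0)"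
proof -
  define b where "b = H z0"
  have b: "Re b > 0" using pos[of z0] \<rho> by (simp add: b_def)
  define \<phi> where "\<phi> = (\<lambda>w. (H (z0 + of_real \<rho> * w) - b) / (H (z0 + of_real \<rho> * w) + cnj b))"
  have inb: "z0 + of_real \<rho> * w \<in> ball z0 \<rho>" if "cmod w < 1" for w
    using that \<rho> by (simp add: dist_norm norm_mult)
  have ne: "H (z0 + of_real \<rho> * w) + cnj b \<noteq> 0" if "cmod w < 1" for w
    using pos[OF inb[OF that]] b by (auto simp: complex_eq_iff)
  have "(\<lambda>w. H (z0 + of_real \<rho> * w)) holomorphic_on ball 0 1"
    using inb by (intro holomorphic_on_compose_gen[OF _ hol, unfolded o_def] holomorphic_intros) auto
  then have "\<phi> holomorphic_on ball 0 1"
    unfolding \<phi>_def using ne by (intro holomorphic_intros) auto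
  moreover have "\<phi> 0 = 0" by (simp add: \<phi>_def b_def)
  moreover have "cmod (\<phi> w) < 1" if "cmod w < 1" for w
    using norm_diff_less_norm_add_cnj[OF pos[OF inb[OF that]] b] ne[OF that]
    by (simp add: \<phi>_def norm_divide)
  ultimately have S: "cmod (\<phi> w) \<le> cmod w" if "cmod w < 1" for w
    using Schwarz_Lemma(1)[of \<phi> w] that by blast
  define w where "w = (z - z0) / of_real \<rho>"
  have w: "cmod w \<le> 1/2" using z \<rho> by (simp add: w_def norm_divide field_simps)
  have zw: "z0 + of_real \<rho> * w = z" using \<rho> by (simp add: w_def)
  have "cmod (\<phi> w) \<le> 1/2" using S[of w] w by simp
  moreover have "\<phi> w = (H z - b) / (H z + cnj b)" by (simp add: \<phi>_def zw)
  moreover have "H z + cnj b \<noteq> 0" using ne[of w] w by (simp add: zw)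
  ultimately have "cmod (H z - b) \<le> 1/2 * cmod (H z + cnj b)"
    by (simp add: norm_divide field_simps)
  \<comment> \<open>After this rewriting |H z - b| recurs on the right with factor 1/2; solving for
    it gives the constant 2.\<close>
  also have "H z + cnj b = (H z - b) + of_real (2 * Re b)" by (simp add: complex_eq_iff)
  also have "1/2 * cmod \<dots> \<le> 1/2 * (cmod (H z - b) + 2 * Re b)"
    using norm_triangle_ineq[of "H z - b" "of_real (2 * Re b)"] b by (simp del: of_real_mult)
  finally show ?thesis by (simp add: b_def)
qed

lemma caratheodory_nonneg:
  assumes hol: "H holomorphic_on ball z0 \<rho>" and \<rho>: "\<rho> > 0"
    and pos: "\<And>z. z \<in> ball z0 \<rho> \<Longrightarrow> Re (H z) \<ge> 0"
    and z: "cmod (z - z0) \<le> \<rho> / 2"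
  shows "cmod (H z - H z0) \<le> 2 * Re (H z0)"
proof (rule field_le_epsilon)
  fix e :: real assume e: "e > 0"
  have "cmod ((H z + of_real (e/2)) - (H z0 + of_real (e/2))) \<le> 2 * Re (H z0 + of_real (e/2))"
  proof (rule caratheodory_pos[of "\<lambda>z. H z + of_real (e/2)" z0 \<rho>])
    show "(\<lambda>z. H z + complex_of_real (e / 2)) holomorphic_on ball z0 \<rho>"
      by (intro holomorphic_intros hol)
    show "0 < Re (H z + complex_of_real (e / 2))" if "z \<in> ball z0 \<rho>" for z
      using pos[OF that] e by simp
  qed (use \<rho> z in auto)
  then show "cmod (H z - H z0) \<le> 2 * Re (H z0) + e" by simp
qed

text \<open>The lower bound on |G| says that Re (g + X) >= 0 for a branch g of log G. Controlling
  the complex logarithm and not only ln |G| is what later permits Cauchy estimates for its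
  derivatives.\<close>

lemma zero_free_log_bounds:
  assumes hol: "G holomorphic_on ball z0 \<rho>" and \<rho>: "\<rho> > 0"
    and low: "\<And>z. z \<in> ball z0 \<rho> \<Longrightarrow> cmod (G z) \<ge> exp (- X)"
  obtains g where "g holomorphic_on ball z0 \<rho>" "\<And>z. z \<in> ball z0 \<rho> \<Longrightarrow> G z = exp (g z)"
    "\<And>z. cmod (z - z0) \<le> \<rho> / 2 \<Longrightarrow> cmod (g z - g z0) \<le> 2 * (ln (cmod (G z0)) + X)"
proof -
  have nz: "G z \<noteq> 0" if "z \<in> ball z0 \<rho>" for z
    using low[OF that] by (metis exp_gt_zero norm_zero not_less)
  obtain g where g: "g holomorphic_on ball z0 \<rho>" "\<And>z. z \<in> ball z0 \<rho> \<Longrightarrow> exp (g z) = G z"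
    using holomorphic_logarithm_exists[of "ball z0 \<rho>" G z0] hol nz \<rho> by auto
  have Re: "Re (g z) = ln (cmod (G z))" if "z \<in> ball z0 \<rho>" for z
    using g(2)[OF that] by (metis norm_exp_eq_Re ln_exp)
  have "cmod ((g z + of_real X) - (g z0 + of_real X)) \<le> 2 * Re (g z0 + of_real X)" if "cmod (z - z0) \<le> \<rho> / 2" for z
  proof (rule caratheodory_nonneg[of "\<lambda>z. g z + of_real X" z0 \<rho>])
    show "0 \<le> Re (g z + complex_of_real X)" if "z \<in> ball z0 \<rho>" for z
    proof -
      have "ln (exp (- X)) \<le> ln (cmod (G z))"
        using low[OF that] nz[OF that] by (subst ln_le_cancel_iff) auto
      then show ?thesis using Re[OF that] by simp
    qed
  qed (use that \<rho> g in \<open>auto intro!: holomorphic_intros\<close>)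
  then have "cmod (g z - g z0) \<le> 2 * (ln (cmod (G z0)) + X)" if "cmod (z - z0) \<le> \<rho> / 2" for z
    using that Re[of z0] \<rho> by simp
  then show thesis using that[of g] g by auto
qed

text \<open>Harnack's inequality for the nonnegative harmonic function ln |G| + X; the factor is 3 =
  1 + 2, with the 2 from \<open>zero_free_log_bounds\<close>.\<close>

lemma harnack_zero_free:
  assumes hol: "G holomorphic_on ball z0 \<rho>" and \<rho>: "\<rho> > 0"
    and low: "\<And>z. z \<in> ball z0 \<rho> \<Longrightarrow> cmod (G z) \<ge> exp (- X)"
    and z: "cmod (z - z0) \<le> \<rho> / 2"
  shows "ln (cmod (G z)) + X \<le> 3 * (ln (cmod (G z0)) + X)"
proof -
  obtain g where g: "\<And>z. z \<in> ball z0 \<rho> \<Longrightarrow> G z = exp (g z)"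
    "\<And>z. cmod (z - z0) \<le> \<rho> / 2 \<Longrightarrow> cmod (g z - g z0) \<le> 2 * (ln (cmod (G z0)) + X)"
    using zero_free_log_bounds[OF hol \<rho>] low by metis
  have "z \<in> ball z0 \<rho>" using z \<rho> by (simp add: dist_norm norm_minus_commute)
  then have "ln (cmod (G z)) = Re (g z)" "ln (cmod (G z0)) = Re (g z0)"
    using g(1) \<rho> by auto
  then have "ln (cmod (G z)) - ln (cmod (G z0)) \<le> cmod (g z - g z0)"
    using complex_Re_le_cmod[of "g z - g z0"] by simp
  then show ?thesis using g(2)[OF z] by simp
qed

text \<open>Cauchy estimates on discs of radius \<open>\<rho>/4\<close>, which stay within
  \<open>\<rho>/2\<close> of \<open>z0\<close>. They are applied to g - g(z0), the quantity that is
  bounded by 2Y; a branch g itself is determined only up to multiples of 2 pi i.\<close>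

lemma zero_free_log_deriv_bounds:
  assumes hol: "G holomorphic_on ball z0 \<rho>" and \<rho>: "\<rho> > 0"
    and low: "\<And>z. z \<in> ball z0 \<rho> \<Longrightarrow> cmod (G z) \<ge> exp (- X)"
  defines "Y \<equiv> ln (cmod (G z0)) + X"
  obtains g where "g holomorphic_on ball z0 \<rho>" "\<And>z. z \<in> ball z0 \<rho> \<Longrightarrow> G z = exp (g z)"
    "\<And>z. cmod (z - z0) \<le> \<rho> / 4 \<Longrightarrow> cmod (deriv g z) \<le> 8 * Y / \<rho>"
    "\<And>z. cmod (z - z0) \<le> \<rho> / 4 \<Longrightarrow> cmod (deriv (deriv g) z) \<le> 64 * Y / \<rho>\<^sup>2"
proof -
  obtain g where g: "g holomorphic_on ball z0 \<rho>" "\<And>z. z \<in> ball z0 \<rho> \<Longrightarrow> G z = exp (g z)"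
    "\<And>z. cmod (z - z0) \<le> \<rho> / 2 \<Longrightarrow> cmod (g z - g z0) \<le> 2 * Y"
    using zero_free_log_bounds[OF hol \<rho>] low unfolding Y_def by metis
  have "cmod ((deriv ^^ n) g z) \<le> fact n * (2 * Y) / (\<rho> / 4) ^ n"
    if z: "cmod (z - z0) \<le> \<rho> / 4" and n: "n > 0" for z n
  proof -
    have sub: "cmod (w - z0) \<le> \<rho> / 2" if "w \<in> cball z (\<rho>/4)" for w
      using that z norm_triangle_ineq[of "w - z" "z - z0"] by (simp add: dist_norm norm_minus_commute)
    have sub': "cball z (\<rho>/4) \<subseteq> ball z0 \<rho>"
      using sub \<rho> by (force simp: dist_norm norm_minus_commute)
    have "cmod ((deriv ^^ n) (\<lambda>w. g w - g z0) z) \<le> fact n * (2 * Y) / (\<rho> / 4) ^ n"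
    proof (rule Cauchy_inequality)
      show "(\<lambda>w. g w - g z0) holomorphic_on ball z (\<rho>/4)"
        using sub' by (intro holomorphic_intros holomorphic_on_subset[OF g(1)]) auto
      show "continuous_on (cball z (\<rho>/4)) (\<lambda>w. g w - g z0)"
        using sub' by (intro holomorphic_on_imp_continuous_on holomorphic_intros holomorphic_on_subset[OF g(1)]) auto
      show "cmod (g x - g z0) \<le> 2 * Y" if "cmod (z - x) = \<rho> / 4" for x
        using g(3) sub[of x] that by (simp add: dist_norm)
    qed (use \<rho> in auto)
    moreover have "(deriv ^^ n) (\<lambda>w. g w - g z0) z = (deriv ^^ n) g z"
      using higher_deriv_diff[of g "ball z0 \<rho>" "\<lambda>_. g z0" z n] g(1) sub' \<rho> n by force
    ultimately show ?thesis by simp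
  qed
  from this[of _ 1] this[of _ 2] have
    "cmod (deriv g z) \<le> 8 * Y / \<rho>" "cmod (deriv (deriv g) z) \<le> 64 * Y / \<rho>\<^sup>2" if "cmod (z - z0) \<le> \<rho> / 4" for z
    using that by (auto simp: numeral_2_eq_2 power_divide field_simps)
  then show thesis using that[of g] g by blast
qed

text \<open>Pigeonhole: of the card Z + 1 annuli of width 2d about \<open>z\<close>, one contains no
  point of \<open>Z\<close>, and its middle circle keeps distance d from \<open>Z\<close>.\<close>

lemma circle_avoiding_finite_set:
  fixes Z :: "complex set"
  assumes "finite Z" "d > 0"
  obtains s where "d \<le> s" "s \<le> (2 * real (card Z) + 1) * d"
    "\<And>w a. cmod (w - z) = s \<Longrightarrow> a \<in> Z \<Longrightarrow> d \<le> cmod (w - a)"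
proof -
  define k where "k = (\<lambda>a. nat \<lfloor>cmod (a - z) / (2 * d)\<rfloor>)"
  have "card (k ` Z) < card {..card Z}"
    using card_image_le[OF assms(1), of k] by simp
  then obtain i where i: "i \<le> card Z" "i \<notin> k ` Z"
    by (metis atMost_iff assms(1) card_mono finite_imageI not_less subsetI)
  define s where "s = (2 * real i + 1) * d"
  have far: "d \<le> cmod (w - a)" if w: "cmod (w - z) = s" and a: "a \<in> Z" for w a
  proof -
    define x where "x = cmod (a - z) / (2 * d)"
    have x: "x \<ge> 0" "cmod (a - z) = x * (2 * d)" using assms by (auto simp: x_def)
    have kx: "real (k a) \<le> x" "x < real (k a) + 1"
      using x(1) by (simp_all add: k_def of_nat_floor flip: x_def)
    have "k a \<noteq> i" using i a by blast
    then consider "k a + 1 \<le> i" | "i + 1 \<le> k a" by linarith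
    then have "d \<le> \<bar>s - cmod (a - z)\<bar>"
    proof cases
      case 1
      then have "x \<le> real i" using kx by linarith
      then have "x * (2 * d) \<le> real i * (2 * d)" using assms by (intro mult_right_mono) auto
      then show ?thesis using x(2) by (simp add: s_def algebra_simps)
    next
      case 2
      then have "real i + 1 \<le> x" using kx by linarith
      then have "(real i + 1) * (2 * d) \<le> x * (2 * d)" using assms by (intro mult_right_mono) auto
      then show ?thesis using x(2) by (simp add: s_def algebra_simps)
    qed
    also have "\<dots> \<le> cmod (w - a)"
      using norm_triangle_ineq3[of "w - z" "a - z"] w by simp
    finally show ?thesis .
  qed
  have "real i \<le> real (card Z)" using i by simp
  then have "s \<le> (2 * real (card Z) + 1) * d" using assms by (simp add: s_def)
  moreover have "d \<le> s" using assms by (simp add: s_def)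
  ultimately show thesis using that far by blast
qed

text \<open>The scale \<open>c\<close> will make every linear factor at most 1 in modulus on the
  relevant disc, in the role of a Blaschke factor. Simplicity of the zeros makes the quotient
  nonzero on \<open>Z\<close>, so that only zeros outside \<open>Z\<close> survive.\<close>

lemma divide_simple_zeros:
  assumes "finite Z" "f holomorphic_on UNIV" "c \<noteq> 0"
    "\<And>a. a \<in> Z \<Longrightarrow> f a = 0" "\<And>a. a \<in> Z \<Longrightarrow> deriv f a \<noteq> 0"
  shows "\<exists>g. g holomorphic_on UNIV \<and> (\<forall>z. f z = (\<Prod>a\<in>Z. (z - a) / c) * g z) \<and> (\<forall>a\<in>Z. g a \<noteq> 0)"
  using assms(1,4,5)
proof (induction Z)
  case empty
  then show ?case using assms(2) by (intro exI[of _ f]) auto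
next
  case (insert b Z)
  then obtain g where g: "g holomorphic_on UNIV" "\<And>z. f z = (\<Prod>a\<in>Z. (z - a) / c) * g z" "\<And>a. a \<in> Z \<Longrightarrow> g a \<noteq> 0"
    by auto
  define p where "p = (\<lambda>z. \<Prod>a\<in>Z. (z - a) / c)"
  have pb: "p b \<noteq> 0" using insert.hyps assms(3) by (auto simp: p_def)
  have gb: "g b = 0" using insert.prems(1)[of b] g(2)[of b] pb by (simp add: p_def)
  \<comment> \<open>The removable quotient at \<open>b\<close>, multiplied by \<open>c\<close> to
    compensate for the scaled linear factor.\<close>
  define k where "k = (\<lambda>z. c * (if z = b then deriv g b else (g z - g b) / (z - b)))"
  have k: "k holomorphic_on UNIV"
    unfolding k_def using pole_lemma[OF g(1), of b] by (intro holomorphic_intros) auto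
  have gk: "g z = (z - b) / c * k z" for z
    using gb assms(3) by (auto simp: k_def)
  have "f z = (\<Prod>a\<in>insert b Z. (z - a) / c) * k z" for z
    using g(2)[of z] gk[of z] insert.hyps by (simp add: mult_ac)
  moreover have "k a \<noteq> 0" if "a \<in> Z" for a
    using gk[of a] g(3)[OF that] by auto
  moreover have "k b \<noteq> 0"
  proof -
    have "p holomorphic_on UNIV" unfolding p_def using assms(3) by (intro holomorphic_intros) auto
    then have "((\<lambda>z. p z * g z) has_field_derivative (p b * deriv g b + deriv p b * g b)) (at b)"
      using g(1) by (intro DERIV_mult' holomorphic_derivI) auto
    moreover have "f = (\<lambda>z. p z * g z)" using g(2) by (auto simp: p_def)
    ultimately have "deriv f b = p b * deriv g b" using gb by (simp add: DERIV_imp_deriv)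
    then show ?thesis using insert.prems(2)[of b] assms(3) by (simp add: k_def)
  qed
  ultimately show ?case using k by (intro exI[of _ k]) auto
qed

text \<open>Half of the admissible radius \<open>c * t\<close> is usable in one Harnack step, so a
  step multiplies \<open>t\<close> by 1 + c/2 at the price of a factor 3.\<close>

lemma harnack_chain:
  assumes G: "G holomorphic_on UNIV" and c: "0 < c" and t0: "0 < t0" and e: "cmod e = 1"
    and low: "\<And>t z. t0 \<le> t \<Longrightarrow> t \<le> R \<Longrightarrow> cmod (z - of_real t * e) < c * t \<Longrightarrow> exp (- X) \<le> cmod (G z)"
    and t: "t0 \<le> t" "t \<le> R" "t \<le> t0 * (1 + c/2) ^ k"
  shows "ln (cmod (G (of_real t * e))) + X \<le> 3 ^ k * (ln (cmod (G (of_real t0 * e))) + X)"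
  using t
proof (induction k arbitrary: t)
  case 0
  then show ?case by simp
next
  case (Suc k)
  \<comment> \<open>The maximum stops the backward step at \<open>t0\<close>, below which no lower
    bound for |G| is available.\<close>
  define t' where "t' = max t0 (t / (1 + c/2))"
  have q: "1 + c/2 > 1" using c by simp
  have t't: "t' \<le> t" using Suc.prems q t0 by (auto simp: t'_def divide_le_eq mult_le_cancel_left1)
  have t': "t0 \<le> t'" "t' \<le> R" "t' \<le> t0 * (1 + c/2) ^ k"
  proof -
    show "t0 \<le> t'" by (simp add: t'_def)
    show "t' \<le> R" using t't Suc.prems by simp
    have "1 \<le> (1 + c/2) ^ k" using q by (simp add: one_le_power)
    then have "t0 \<le> t0 * (1 + c/2) ^ k" using t0 by simp
    moreover have "t / (1 + c/2) \<le> t0 * (1 + c/2) ^ k"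
      using Suc.prems(3) q by (simp add: divide_le_eq mult_ac)
    ultimately show "t' \<le> t0 * (1 + c/2) ^ k" by (simp add: t'_def)
  qed
  have "t / (1 + c/2) \<le> t'" by (simp add: t'_def)
  then have tt: "t \<le> t' * (1 + c/2)" using q by (subst (asm) pos_divide_le_eq) auto
  have "ln (cmod (G (of_real t * e))) + X \<le> 3 * (ln (cmod (G (of_real t' * e))) + X)"
  proof (rule harnack_zero_free[of G "of_real t' * e" "c * t'"])
    show "exp (- X) \<le> cmod (G z)" if "z \<in> ball (of_real t' * e) (c * t')" for z
      using low[of t' z] that t' by (simp add: dist_norm norm_minus_commute)
    have "cmod (of_real t * e - of_real t' * e) = \<bar>t - t'\<bar>"
      using e by (metis mult.right_neutral norm_mult norm_of_real of_real_diff left_diff_distrib)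
    then show "cmod (of_real t * e - of_real t' * e) \<le> c * t' / 2"
      using tt t't by (simp add: algebra_simps)
  qed (use G c t' t0 in \<open>auto intro: holomorphic_on_subset\<close>)
  also have "\<dots> \<le> 3 * (3 ^ k * (ln (cmod (G (of_real t0 * e))) + X))"
    using Suc.IH[OF t'] by simp
  finally show ?case by simp
qed

section \<open>Wronskians and the Riccati equation\<close>

text \<open>The Wronskian equals f g (g'/g - f'/f), and each logarithmic derivative is at most
  2/d.\<close>

lemma solution_pair_lower_bound:
  assumes f: "ode_solution A f" and g: "ode_solution A g" and d: "d > 0"
    and K: "\<And>w. w \<in> cball z d \<Longrightarrow> cmod (A w) \<le> K" and Kd: "K * d\<^sup>2 \<le> 1/16"
    and nz: "\<And>w. cmod (w - z) < d \<Longrightarrow> f w \<noteq> 0" "\<And>w. cmod (w - z) < d \<Longrightarrow> g w \<noteq> 0"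
  shows "cmod (f z * deriv g z - deriv f z * g z) * d / 4 \<le> cmod (f z * g z)"
proof -
  have F: "d * cmod (deriv f z) \<le> 2 * cmod (f z)"
    using solution_log_deriv_bound[OF f d _ Kd nz(1)] K by blast
  have G: "d * cmod (deriv g z) \<le> 2 * cmod (g z)"
    using solution_log_deriv_bound[OF g d _ Kd nz(2)] K by blast
  have "cmod (f z * deriv g z - deriv f z * g z) \<le> cmod (f z) * cmod (deriv g z) + cmod (deriv f z) * cmod (g z)"
    using norm_triangle_ineq4[of "f z * deriv g z" "deriv f z * g z"] by (simp add: norm_mult)
  then have "cmod (f z * deriv g z - deriv f z * g z) * d
      \<le> (cmod (f z) * cmod (deriv g z) + cmod (deriv f z) * cmod (g z)) * d"
    using d by (intro mult_right_mono) auto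
  also have "\<dots> = cmod (f z) * (d * cmod (deriv g z)) + (d * cmod (deriv f z)) * cmod (g z)"
    by (simp add: algebra_simps)
  also have "\<dots> \<le> cmod (f z) * (2 * cmod (g z)) + (2 * cmod (f z)) * cmod (g z)"
    using F G by (intro add_mono mult_left_mono mult_right_mono) auto
  finally show ?thesis by (simp add: norm_mult)
qed

lemma wronskian_constant:
  assumes "ode_solution A f" "ode_solution A g"
  shows "f z * deriv g z - deriv f z * g z = f 0 * deriv g 0 - deriv f 0 * g 0"
proof -
  have "((\<lambda>z. f z * deriv g z - deriv f z * g z) has_field_derivative 0) (at x)" for x
    by (rule derivative_eq_intros solution_derivs[OF assms(1)] solution_derivs[OF assms(2)] refl)+
      (simp add: algebra_simps)
  then show ?thesis
    using has_field_derivative_zero_constant[of UNIV "\<lambda>z. f z * deriv g z - deriv f z * g z"] by auto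
qed

lemma solution_zero_simple:
  assumes "ode_solution A f" "continuous_on UNIV A" "f z0 \<noteq> 0" "f a = 0"
  shows "deriv f a \<noteq> 0"
  using solution_zero_data_imp_zero[OF assms(1,2,4)] assms(3) by blast

lemma has_field_derivative_prod_linear:
  fixes Z :: "complex set"
  assumes "finite Z" "z \<notin> Z" "c \<noteq> 0"
  shows "((\<lambda>z. \<Prod>a\<in>Z. (z - a) / c) has_field_derivative (\<Prod>a\<in>Z. (z - a) / c) * (\<Sum>a\<in>Z. 1 / (z - a))) (at z)"
  using assms(1,2)
proof (induction Z)
  case (insert b Z)
  have "((\<lambda>z. (z - b) / c * (\<Prod>a\<in>Z. (z - a) / c)) has_field_derivative
      (z - b) / c * ((\<Prod>a\<in>Z. (z - a) / c) * (\<Sum>a\<in>Z. 1 / (z - a))) + 1 / c * (\<Prod>a\<in>Z. (z - a) / c)) (at z)"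
    using insert by (intro DERIV_mult') (auto intro!: derivative_eq_intros simp: assms)
  moreover have "(z - b) / c * (p * q) + 1 / c * p = (z - b) / c * p * (1 / (z - b) + q)" for p q :: complex
    using insert.prems assms(3) by (simp add: field_simps)
  ultimately show ?case using insert.hyps by simp
qed simp

text \<open>The Riccati equation \<open>v' + v\<^sup>2 = - A\<close> for the logarithmic derivative \<open>v\<close> of a solution.\<close>

lemma coefficient_from_log_deriv:
  assumes sol: "ode_solution A f" and Z: "finite Z" and c: "c \<noteq> 0" and g: "g holomorphic_on U" "open U"
    and f: "\<And>z. z \<in> U \<Longrightarrow> f z = (\<Prod>a\<in>Z. (z - a) / c) * exp (g z)"
    and w: "w \<in> U" "w \<notin> Z"
  shows "- A w = (deriv (deriv g) w - (\<Sum>a\<in>Z. 1 / (w - a)\<^sup>2)) + (deriv g w + (\<Sum>a\<in>Z. 1 / (w - a)))\<^sup>2"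
proof -
  define v where "v = (\<lambda>z. deriv g z + (\<Sum>a\<in>Z. 1 / (z - a)))"
  define V where "V = U - Z"
  have V: "open V" "w \<in> V" using g(2) Z w by (auto simp: V_def finite_imp_closed)
  have df: "deriv f z = f z * v z" if "z \<in> V" for z
  proof -
    have z: "z \<in> U" "z \<notin> Z" using that by (auto simp: V_def)
    have "((\<lambda>z. (\<Prod>a\<in>Z. (z - a) / c) * exp (g z)) has_field_derivative
        (\<Prod>a\<in>Z. (z - a) / c) * (exp (g z) * deriv g z) + (\<Prod>a\<in>Z. (z - a) / c) * (\<Sum>a\<in>Z. 1 / (z - a)) * exp (g z)) (at z)"
      using has_field_derivative_prod_linear[OF Z z(2) c] holomorphic_derivI[OF g z(1)]
      by (intro DERIV_mult') (auto intro!: derivative_eq_intros)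
    then have "(f has_field_derivative (\<Prod>a\<in>Z. (z - a) / c) * (exp (g z) * deriv g z) + (\<Prod>a\<in>Z. (z - a) / c) * (\<Sum>a\<in>Z. 1 / (z - a)) * exp (g z)) (at z)"
      by (rule has_field_derivative_transform_within_open[OF _ g(2) z(1)]) (simp add: f)
    then show ?thesis using f[OF z(1)] by (simp add: v_def DERIV_imp_deriv algebra_simps)
  qed
  have dv: "(v has_field_derivative deriv (deriv g) w - (\<Sum>a\<in>Z. 1 / (w - a)\<^sup>2)) (at w)"
  proof -
    have 1: "(deriv g has_field_derivative deriv (deriv g) w) (at w)"
      using g w by (intro holomorphic_derivI[of _ U] holomorphic_deriv) auto
    have 2: "((\<lambda>z. 1 / (z - a)) has_field_derivative - (1 / (w - a)\<^sup>2)) (at w)" if "a \<in> Z" for a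
    proof -
      have "w - a \<noteq> 0" using that w by auto
      then show ?thesis by (auto intro!: derivative_eq_intros simp: power2_eq_square)
    qed
    have "(v has_field_derivative deriv (deriv g) w + (\<Sum>a\<in>Z. - (1 / (w - a)\<^sup>2))) (at w)"
      unfolding v_def by (intro DERIV_add 1 DERIV_sum 2)
    then show ?thesis by (simp add: sum_negf)
  qed
  have "((\<lambda>z. f z * v z) has_field_derivative f w * (deriv (deriv g) w - (\<Sum>a\<in>Z. 1 / (w - a)\<^sup>2)) + deriv f w * v w) (at w)"
    using solution_derivs(1)[OF sol] dv by (rule DERIV_mult')
  then have "(deriv f has_field_derivative f w * (deriv (deriv g) w - (\<Sum>a\<in>Z. 1 / (w - a)\<^sup>2)) + deriv f w * v w) (at w)"
    by (rule has_field_derivative_transform_within_open[OF _ V]) (simp add: df)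
  from DERIV_unique[OF this solution_derivs(2)[OF sol]]
  have "f w * (- A w) = f w * ((deriv (deriv g) w - (\<Sum>a\<in>Z. 1 / (w - a)\<^sup>2)) + (v w)\<^sup>2)"
    using df[OF V(2)] by (simp add: algebra_simps power2_eq_square)
  moreover have "f w \<noteq> 0" using f[OF w(1)] w(2) Z c by auto
  ultimately show ?thesis unfolding v_def by (simp only: mult_left_cancel[of "f w"] not_False_eq_True)
qed

text \<open>\<open>Y\<close> covers the zero-free factor, and each zero adds at most 1/d and 1/d^2
  to the two sums. The dependence on 1/d is polynomial, which dictates the distance used when this
  is applied.\<close>

lemma norm_coefficient_le:
  assumes sol: "ode_solution A f" and Z: "finite Z" and c: "c \<noteq> 0" and g: "g holomorphic_on U" "open U"
    and f: "\<And>z. z \<in> U \<Longrightarrow> f z = (\<Prod>a\<in>Z. (z - a) / c) * exp (g z)" and w: "w \<in> U"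
    and d: "d > 0" and far: "\<And>a. a \<in> Z \<Longrightarrow> d \<le> cmod (w - a)"
    and Y: "cmod (deriv g w) \<le> Y" "cmod (deriv (deriv g) w) \<le> Y"
  shows "cmod (A w) \<le> Y + real (card Z) / d\<^sup>2 + (Y + real (card Z) / d)\<^sup>2"
proof -
  have "w \<notin> Z" using far[of w] d by auto
  have a1: "cmod (\<Sum>a\<in>Z. 1 / (w - a)) \<le> real (card Z) / d"
  proof -
    have "cmod (\<Sum>a\<in>Z. 1 / (w - a)) \<le> (\<Sum>a\<in>Z. 1 / d)"
    proof (intro order.trans[OF norm_sum] sum_mono)
      fix a assume "a \<in> Z"
      then show "cmod (1 / (w - a)) \<le> 1 / d"
        using far[of a] d by (simp add: norm_divide frac_le)
    qed
    then show ?thesis by simp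
  qed
  have a2: "cmod (\<Sum>a\<in>Z. 1 / (w - a)\<^sup>2) \<le> real (card Z) / d\<^sup>2"
  proof -
    have "cmod (\<Sum>a\<in>Z. 1 / (w - a)\<^sup>2) \<le> (\<Sum>a\<in>Z. 1 / d\<^sup>2)"
    proof (intro order.trans[OF norm_sum] sum_mono)
      fix a assume "a \<in> Z"
      then have "d \<le> cmod (w - a)" by (rule far)
    then have "d\<^sup>2 \<le> (cmod (w - a))\<^sup>2" using d by (intro power_mono) auto
      then show "cmod (1 / (w - a)\<^sup>2) \<le> 1 / d\<^sup>2"
        using d by (simp add: norm_divide norm_power frac_le)
    qed
    then show ?thesis by simp
  qed
  have eq: "- A w = (deriv (deriv g) w - (\<Sum>a\<in>Z. 1 / (w - a)\<^sup>2)) + (deriv g w + (\<Sum>a\<in>Z. 1 / (w - a)))\<^sup>2"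
    by (rule coefficient_from_log_deriv[of A f Z c g U w]) (use sol Z c g f w \<open>w \<notin> Z\<close> in auto)
  have "cmod (A w) = cmod (- A w)" by simp
  also have "\<dots> \<le> cmod (deriv (deriv g) w - (\<Sum>a\<in>Z. 1 / (w - a)\<^sup>2)) + cmod (deriv g w + (\<Sum>a\<in>Z. 1 / (w - a))) ^ 2"
    unfolding eq
    by (rule order.trans[OF norm_triangle_ineq]) (simp add: norm_power)
  also have "\<dots> \<le> (Y + real (card Z) / d\<^sup>2) + (Y + real (card Z) / d)\<^sup>2"
  proof (intro add_mono power_mono)
    show "cmod (deriv (deriv g) w - (\<Sum>a\<in>Z. 1 / (w - a)\<^sup>2)) \<le> Y + real (card Z) / d\<^sup>2"
      using norm_triangle_ineq4[of "deriv (deriv g) w" "\<Sum>a\<in>Z. 1 / (w - a)\<^sup>2"] a2 Y by linarith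
    show "cmod (deriv g w + (\<Sum>a\<in>Z. 1 / (w - a))) \<le> Y + real (card Z) / d"
      using norm_triangle_ineq[of "deriv g w" "\<Sum>a\<in>Z. 1 / (w - a)"] a1 Y by linarith
  qed auto
  finally show ?thesis .
qed

text \<open>Division by \<open>of_real t * cis \<theta>\<close> moves the claim to a neighbourhood
  of 1, where \<open>Arg\<close> is continuous; by this scaling one \<open>c\<close> serves all
  \<open>t\<close>.\<close>

lemma ball_subset_sector:
  assumes "\<epsilon> > 0"
  obtains c where "0 < c" "c \<le> 1" "\<And>t z. t > 0 \<Longrightarrow> cmod (z - of_real t * cis \<theta>) < c * t \<Longrightarrow> z \<in> sector \<theta> \<epsilon>"
proof -
  have "isCont Arg 1" by (rule continuous_at_Arg) auto
  then have "eventually (\<lambda>w. dist (Arg w) (Arg 1) < \<epsilon>) (nhds 1)"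
    unfolding isCont_def tendsto_at_iff_tendsto_nhds using assms by (rule tendstoD)
  then obtain c0 where c0: "c0 > 0" "\<And>w. dist w 1 < c0 \<Longrightarrow> \<bar>Arg w\<bar> < \<epsilon>"
    by (auto simp: eventually_nhds_metric dist_norm)
  \<comment> \<open>The cap 1 also keeps \<open>w\<close> away from 0, since then |w - 1| <
    1.\<close>
  define c where "c = min c0 1"
  have "z \<in> sector \<theta> \<epsilon>" if t: "t > 0" and z: "cmod (z - of_real t * cis \<theta>) < c * t" for t z
  proof -
    define w where "w = z / (of_real t * cis \<theta>)"
    have zw: "z = of_real t * cis \<theta> * w" using t by (simp add: w_def)
    have "z - of_real t * cis \<theta> = of_real t * cis \<theta> * (w - 1)" by (simp add: zw algebra_simps)
    then have "cmod (w - 1) < c" using z t by (simp add: norm_mult)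
    then have w: "dist w 1 < c0" "dist w 1 < 1" by (auto simp: c_def dist_norm)
    have "w \<noteq> 0" using w(2) by auto
    have "w = of_real (cmod w) * cis (Arg w)"
      by (metis rcis_cmod_Arg rcis_def)
    then have "z = of_real (t * cmod w) * cis (\<theta> + Arg w)"
      by (subst zw) (simp add: cis_mult[symmetric] mult_ac)
    then have "is_Arg z (\<theta> + Arg w)"
      using t by (auto simp: is_Arg_def norm_mult cis_conv_exp mult_ac)
    then show ?thesis using \<open>w \<noteq> 0\<close> t c0(2)[OF w(1)] zw by (auto simp: sector_def intro!: exI[of _ "\<theta> + Arg w"])
  qed
  then show thesis using that[of c] c0 by (auto simp: c_def)
qed

section \<open>Exponential polynomials\<close>

lemma log_plus_le:
  assumes "x \<le> exp b" "0 \<le> b"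
  shows "log_plus x \<le> b"
proof (cases "x \<le> 1")
  case False
  then have "ln x \<le> ln (exp b)" using assms by (subst ln_le_cancel_iff) auto
  then show ?thesis using False by (simp add: log_plus_def)
qed (use assms in \<open>simp add: log_plus_def\<close>)

lemma le_exp_log_plus: "x \<le> exp (log_plus x)"
  by (simp add: log_plus_def)

lemma log_log_quotient_le:
  assumes "x \<le> exp (r powr a)" "r > 1" "0 \<le> a"
  shows "log_plus (log_plus x) / ln r \<le> a"
proof -
  have "log_plus x \<le> r powr a" using assms by (intro log_plus_le) auto
  also have "\<dots> = exp (a * ln r)" using assms by (simp add: powr_def)
  finally have "log_plus (log_plus x) \<le> a * ln r"
    by (rule log_plus_le) (use assms in auto)
  then show ?thesis using assms by (simp add: divide_le_eq)
qed

lemma log_log_quotient_less_imp: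
  assumes "log_plus (log_plus x) / ln r < a" "r > 1"
  shows "x \<le> exp (r powr a)"
proof -
  have "log_plus (log_plus x) < a * ln r" using assms by (simp add: divide_less_eq)
  then have "log_plus x \<le> exp (a * ln r)"
    using le_exp_log_plus[of "log_plus x"] by (smt (verit) exp_less_cancel_iff)
  then have "log_plus x \<le> r powr a" using assms by (simp add: powr_def)
  then show ?thesis using le_exp_log_plus[of x] by (smt (verit) exp_le_cancel_iff)
qed

text \<open>Constant terms of exponents move into the coefficients, equal exponents are merged, and
  vanishing coefficients are dropped. Distinct exponents then differ by a nonconstant polynomial, so
  terms can be separated by size on a suitable ray.\<close>

lemma exponential_polynomial_reduced:
  assumes "exponential_polynomial A"
  shows "\<exists>J P. finite J \<and> (\<forall>Q\<in>J. coeff Q 0 = 0 \<and> P Q \<noteq> 0) \<and>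
    A = (\<lambda>z. \<Sum>Q\<in>J. poly (P Q) z * exp (poly Q z))"
proof -
  obtain k P0 Q0 where A: "A = (\<lambda>z. \<Sum>j<(k::nat). poly (P0 j) z * exp (poly (Q0 j) z))"
    using assms by (auto simp: exponential_polynomial_def)
  define R where "R = (\<lambda>j. Q0 j - [:coeff (Q0 j) 0:])"
  define P where "P = (\<lambda>Q. \<Sum>j\<in>{j. j < k \<and> R j = Q}. smult (exp (coeff (Q0 j) 0)) (P0 j))"
  define J where "J = {Q \<in> R ` {..<k}. P Q \<noteq> 0}"
  have "A z = (\<Sum>Q\<in>J. poly (P Q) z * exp (poly Q z))" for z
  proof -
    have "A z = (\<Sum>j<k. exp (coeff (Q0 j) 0) * poly (P0 j) z * exp (poly (R j) z))"
      unfolding A by (intro sum.cong) (auto simp: R_def mult_exp_exp algebra_simps simp flip: exp_add)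
    also have "\<dots> = (\<Sum>Q\<in>R ` {..<k}. \<Sum>j\<in>{j. j < k \<and> R j = Q}. exp (coeff (Q0 j) 0) * poly (P0 j) z * exp (poly (R j) z))"
      by (subst sum.image_gen[of _ _ R]) auto
    also have "\<dots> = (\<Sum>Q\<in>R ` {..<k}. poly (P Q) z * exp (poly Q z))"
      by (intro sum.cong refl) (auto simp: P_def poly_sum sum_distrib_right)
    also have "\<dots> = (\<Sum>Q\<in>J. poly (P Q) z * exp (poly Q z))"
      by (intro sum.mono_neutral_right) (auto simp: J_def)
    finally show ?thesis .
  qed
  then show ?thesis by (intro exI[of _ J] exI[of _ P]) (auto simp: J_def R_def)
qed

lemma norm_poly_le:
  fixes p :: "complex poly"
  assumes "degree p \<le> n" "cmod z \<ge> 1"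
  shows "cmod (poly p z) \<le> (\<Sum>i\<le>n. cmod (coeff p i)) * cmod z ^ n"
proof -
  have "poly p z = (\<Sum>i\<le>n. coeff p i * z ^ i)"
    unfolding poly_altdef using assms(1) by (intro sum.mono_neutral_left) (auto simp: coeff_eq_0)
  also have "cmod \<dots> \<le> (\<Sum>i\<le>n. cmod (coeff p i) * cmod z ^ i)"
    by (rule order.trans[OF norm_sum]) (simp add: norm_mult norm_power)
  also have "\<dots> \<le> (\<Sum>i\<le>n. cmod (coeff p i) * cmod z ^ n)"
    using assms by (intro sum_mono mult_left_mono power_increasing) auto
  finally show ?thesis by (simp add: sum_distrib_right)
qed

lemma norm_exp_sum_le:
  assumes "finite J" "\<And>Q. Q \<in> J \<Longrightarrow> degree Q \<le> d"
  obtains C m where "C \<ge> 0" "\<And>z. cmod z \<ge> 1 \<Longrightarrow>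
    cmod (\<Sum>Q\<in>J. poly (P Q) z * exp (poly Q z)) \<le> C * cmod z ^ m * exp (C * cmod z ^ d)"
proof -
  have "\<exists>C m. C \<ge> 0 \<and> (\<forall>z. cmod z \<ge> 1 \<longrightarrow> 
    cmod (\<Sum>Q\<in>J. poly (P Q) z * exp (poly Q z)) \<le> C * cmod z ^ m * exp (C * cmod z ^ d))"
    using assms
  proof (induction J)
    case empty
    then show ?case by (intro exI[of _ 0]) auto
  next
    case (insert Q J)
    then obtain C m where C: "C \<ge> 0" "\<And>z. cmod z \<ge> 1 \<Longrightarrow> 
      cmod (\<Sum>Q\<in>J. poly (P Q) z * exp (poly Q z)) \<le> C * cmod z ^ m * exp (C * cmod z ^ d)" by auto
    define a where "a = (\<Sum>i\<le>degree (P Q). cmod (coeff (P Q) i))"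
    define b where "b = (\<Sum>i\<le>d. cmod (coeff Q i))"
    have ab: "a \<ge> 0" "b \<ge> 0" by (auto simp: a_def b_def intro: sum_nonneg)
    define D where "D = C + a + b"
    define m' where "m' = m + degree (P Q)"
    have "cmod (\<Sum>Q\<in>insert Q J. poly (P Q) z * exp (poly Q z)) \<le> D * cmod z ^ m' * exp (D * cmod z ^ d)"
      if z: "cmod z \<ge> 1" for z
    proof -
      have "cmod (poly (P Q) z) \<le> a * cmod z ^ degree (P Q)"
        unfolding a_def using z by (intro norm_poly_le) auto
      also have "\<dots> \<le> a * cmod z ^ m'"
        using z ab by (intro mult_left_mono power_increasing) (auto simp: m'_def)
      finally have 1: "cmod (poly (P Q) z) \<le> a * cmod z ^ m'" .
      have "cmod (exp (poly Q z)) \<le> exp (cmod (poly Q z))" by (rule norm_exp)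
      also have "\<dots> \<le> exp (b * cmod z ^ d)"
        unfolding b_def using z insert.prems by (simp add: norm_poly_le)
      also have "\<dots> \<le> exp (D * cmod z ^ d)" using C(1) ab by (simp add: D_def mult_right_mono)
      finally have 2: "cmod (poly (P Q) z * exp (poly Q z)) \<le> (a * cmod z ^ m') * exp (D * cmod z ^ d)"
        unfolding norm_mult using 1 ab by (intro mult_mono) auto
      have "C * cmod z ^ m * exp (C * cmod z ^ d) \<le> C * cmod z ^ m' * exp (D * cmod z ^ d)"
        using C(1) ab z by (intro mult_mono mult_left_mono power_increasing) (auto simp: m'_def D_def mult_right_mono)
      then have "cmod (\<Sum>Q\<in>insert Q J. poly (P Q) z * exp (poly Q z))
          \<le> (a * cmod z ^ m') * exp (D * cmod z ^ d) + C * cmod z ^ m' * exp (D * cmod z ^ d)"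
        using 2 C(2)[OF z] insert.hyps by (simp add: norm_triangle_le)
      also have "\<dots> = (a + C) * (cmod z ^ m' * exp (D * cmod z ^ d))" by (simp add: algebra_simps)
      also have "\<dots> \<le> D * (cmod z ^ m' * exp (D * cmod z ^ d))"
        using ab by (intro mult_right_mono) (auto simp: D_def)
      finally show ?thesis by (simp add: mult_ac)
    qed
    then show ?case using C(1) ab by (intro exI[of _ D] exI[of _ m']) (auto simp: D_def)
  qed
  then show thesis using that by blast
qed

text \<open>Used backwards: an exponential sum of order n must contain an exponent of degree at
  least n.\<close>

lemma growth_order_le:
  assumes C: "C \<ge> 0" and "\<And>z. cmod z \<ge> 1 \<Longrightarrow> cmod (A z) \<le> C * cmod z ^ m * exp (C * cmod z ^ d)"
  shows "growth_order A \<le> ereal (real d)"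
proof (rule ereal_le_epsilon2)
  fix \<eta> :: real assume \<eta>: "\<eta> > 0"
  \<comment> \<open>\<open>C + 1\<close> replaces \<open>C\<close> so that the logarithm makes sense
    when C = 0.\<close>
  have "eventually (\<lambda>r. (C + 1) * r ^ m * exp (C * r ^ d) \<le> exp (r powr (real d + \<eta>))) at_top"
  proof -
    have "eventually (\<lambda>r. ln (C + 1) + real m * ln r + C * r powr real d \<le> r powr (real d + \<eta>)) at_top"
    proof -
      define a where "a = real d + \<eta>"
      have a: "a > 0" using \<eta> by (simp add: a_def)
      have "((\<lambda>r::real. 1 / r powr a) \<longlongrightarrow> 0) at_top" "((\<lambda>r::real. ln r / r powr a) \<longlongrightarrow> 0) at_top"
        "((\<lambda>r::real. r powr (- \<eta>)) \<longlongrightarrow> 0) at_top"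
        using a \<eta> by real_asymp+
      then have "((\<lambda>r. ln (C + 1) * (1 / r powr a) + real m * (ln r / r powr a) + C * r powr (- \<eta>))
          \<longlongrightarrow> ln (C + 1) * 0 + real m * 0 + C * 0) at_top"
        by (intro tendsto_intros)
      then have "eventually (\<lambda>r. ln (C + 1) * (1 / r powr a) + real m * (ln r / r powr a) + C * r powr (- \<eta>) < 1) at_top"
        by (rule order_tendstoD) simp
      then show ?thesis using eventually_gt_at_top[of 0]
      proof eventually_elim
        case (elim r)
        have "r powr a > 0" using elim by simp
        then have "(ln (C + 1) * (1 / r powr a) + real m * (ln r / r powr a) + C * r powr (- \<eta>)) * r powr a \<le> 1 * r powr a"
          using elim by (intro mult_right_mono) auto
        moreover have "r powr (- \<eta>) * r powr a = r powr real d" by (simp add: a_def flip: powr_add)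
        ultimately show ?case using \<open>r powr a > 0\<close> by (simp add: algebra_simps) (simp add: a_def algebra_simps)
      qed
    qed
    then show ?thesis using eventually_gt_at_top[of 0]
    proof eventually_elim
      case (elim r)
      have "(C + 1) * r ^ m * exp (C * r ^ d) = exp (ln (C + 1) + real m * ln r + C * r powr real d)"
        using elim C by (simp add: exp_add powr_realpow exp_of_nat_mult)
      then show ?case using elim by simp
    qed
  qed
  then have "eventually (\<lambda>r. ereal (log_plus (log_plus (max_modulus A r)) / ln r) \<le> ereal (real d + \<eta>)) at_top"
    using eventually_gt_at_top[of 1]
  proof eventually_elim
    case (elim r)
    have "max_modulus A r \<le> C * r ^ m * exp (C * r ^ d)"
      unfolding max_modulus_def using elim assms(2) by (intro cSUP_least) (auto simp: dist_norm)
    also have "\<dots> \<le> (C + 1) * r ^ m * exp (C * r ^ d)"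
      using C elim by (intro mult_right_mono) auto
    finally show ?case using elim \<eta> by (simp add: log_log_quotient_le)
  qed
  then have "growth_order A \<le> ereal (real d + \<eta>)"
    unfolding growth_order_def by (rule Limsup_bounded)
  then show "growth_order A \<le> ereal (real d) + ereal \<eta>" by simp
qed

section \<open>Polynomials along a ray and the choice of a generic ray\<close>

lemma poly_on_ray_tendsto:
  fixes D :: "complex poly"
  shows "((\<lambda>r. poly D (of_real r * cis \<theta>) / of_real (r ^ degree D)) \<longlongrightarrow> lead_coeff D * cis (real (degree D) * \<theta>)) at_top"
proof -
  define e where "e = degree D"
  have "((\<lambda>r. \<Sum>i\<le>e. coeff D i * cis (real i * \<theta>) * of_real (r ^ i / r ^ e))
      \<longlongrightarrow> (\<Sum>i\<le>e. coeff D i * cis (real i * \<theta>) * of_real (if i = e then 1 else 0))) at_top"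
  proof (intro tendsto_sum tendsto_mult tendsto_const tendsto_of_real)
    fix i assume i: "i \<in> {..e}"
    show "((\<lambda>r::real. r ^ i / r ^ e) \<longlongrightarrow> (if i = e then 1 else 0)) at_top"
    proof (cases "i = e")
      case True
      have "((\<lambda>r::real. r ^ i / r ^ e) \<longlongrightarrow> 1) at_top"
        by (rule tendsto_eventually, rule eventually_mono[OF eventually_gt_at_top[of 0]]) (auto simp: True)
      then show ?thesis using True by simp
    next
      case False
      then have ie: "i < e" using i by simp
      have "((\<lambda>r::real. inverse (r ^ (e - i))) \<longlongrightarrow> 0) at_top"
        using ie by (intro tendsto_inverse_0_at_top filterlim_pow_at_top filterlim_ident) auto
      moreover have "eventually (\<lambda>r::real. inverse (r ^ (e - i)) = r ^ i / r ^ e) at_top"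
        using eventually_gt_at_top[of 0]
        by eventually_elim (use ie in \<open>simp add: power_diff field_simps\<close>)
      ultimately have "((\<lambda>r::real. r ^ i / r ^ e) \<longlongrightarrow> 0) at_top"
        by (rule Lim_transform_eventually)
      then show ?thesis using False by simp
    qed
  qed
  also have "(\<Sum>i\<le>e. coeff D i * cis (real i * \<theta>) * of_real (if i = e then 1 else 0)) = coeff D e * cis (real e * \<theta>)"
    by (simp add: if_distrib sum.delta' cong: if_cong)
  finally show ?thesis
    unfolding e_def
    by (rule Lim_transform_eventually)
      (auto simp: poly_altdef power_mult_distrib Complex.DeMoivre sum_divide_distrib intro!: always_eventually sum.cong)
qed

lemma Re_poly_on_ray_ge:
  assumes "Re (lead_coeff D * cis (real (degree D) * \<theta>)) > 0"
  obtains c where "c > 0" "eventually (\<lambda>r. Re (poly D (of_real r * cis \<theta>)) \<ge> c * r ^ degree D) at_top"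
proof -
  define l where "l = Re (lead_coeff D * cis (real (degree D) * \<theta>))"
  have "((\<lambda>r. Re (poly D (of_real r * cis \<theta>) / of_real (r ^ degree D))) \<longlongrightarrow> l) at_top"
    unfolding l_def by (intro tendsto_intros poly_on_ray_tendsto)
  moreover have "l / 2 < l" using assms by (simp add: l_def)
  ultimately have "eventually (\<lambda>r. l / 2 < Re (poly D (of_real r * cis \<theta>) / of_real (r ^ degree D))) at_top"
    by (rule order_tendstoD)
  then have "eventually (\<lambda>r. Re (poly D (of_real r * cis \<theta>)) \<ge> l / 2 * r ^ degree D) at_top"
    using eventually_gt_at_top[of 0]
    by eventually_elim (simp add: Re_divide_of_real pos_less_divide_eq del: of_real_power)
  then show thesis using that[of "l / 2"] assms by (simp add: l_def)
qed

lemma norm_poly_on_ray_ge: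
  fixes D :: "complex poly"
  assumes "D \<noteq> 0"
  obtains c where "c > 0" "eventually (\<lambda>r. cmod (poly D (of_real r * cis \<theta>)) \<ge> c) at_top"
proof -
  define l where "l = cmod (lead_coeff D)"
  have l: "l > 0" using assms by (simp add: l_def)
  have "((\<lambda>r. cmod (poly D (of_real r * cis \<theta>) / of_real (r ^ degree D))) \<longlongrightarrow> cmod (lead_coeff D * cis (real (degree D) * \<theta>))) at_top"
    by (intro tendsto_intros poly_on_ray_tendsto)
  moreover have "l / 2 < cmod (lead_coeff D * cis (real (degree D) * \<theta>))" using l by (simp add: l_def norm_mult)
  ultimately have "eventually (\<lambda>r. l / 2 < cmod (poly D (of_real r * cis \<theta>) / of_real (r ^ degree D))) at_top"
    by (rule order_tendstoD)
  then have "eventually (\<lambda>r. cmod (poly D (of_real r * cis \<theta>)) \<ge> l / 2) at_top"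
    using eventually_ge_at_top[of 1]
  proof eventually_elim
    case (elim r)
    then have "l / 2 * r ^ degree D \<le> cmod (poly D (of_real r * cis \<theta>))"
      by (simp add: norm_divide norm_power pos_less_divide_eq)
    moreover have "l / 2 * 1 \<le> l / 2 * r ^ degree D"
      using elim l by (intro mult_left_mono) auto
    ultimately show ?case by simp
  qed
  then show thesis using that[of "l / 2"] l by simp
qed

text \<open>The real part is |c| cos(Arg c + e theta), so the angles lie in an arithmetic
  progression. Countability suffices for avoiding finitely many such sets inside an
  interval.\<close>

lemma countable_degenerate_rays:
  fixes c :: complex
  assumes "c \<noteq> 0" "e > 0"
  shows "countable {\<theta>. Re (c * cis (real e * \<theta>)) = 0}"
proof (rule countable_subset)
  show "{\<theta>. Re (c * cis (real e * \<theta>)) = 0} \<subseteq> range (\<lambda>i::int. (of_int i * (pi / 2) - Arg c) / real e)"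
  proof
    fix \<theta> assume "\<theta> \<in> {\<theta>. Re (c * cis (real e * \<theta>)) = 0}"
    then have "Re (rcis (cmod c) (Arg c) * cis (real e * \<theta>)) = 0" by (simp add: rcis_cmod_Arg)
    then have "cmod c * cos (Arg c + real e * \<theta>) = 0" by (simp add: rcis_def cis_mult mult.assoc)
    then have "cos (Arg c + real e * \<theta>) = 0" using assms by simp
    then obtain i :: int where "Arg c + real e * \<theta> = of_int i * (pi / 2)"
      unfolding cos_zero_iff_int by blast
    then have "\<theta> = (of_int i * (pi / 2) - Arg c) / real e" using assms by (simp add: field_simps)
    then show "\<theta> \<in> range (\<lambda>i::int. (of_int i * (pi / 2) - Arg c) / real e)" by blast
  qed
qed simp

text \<open>On such a ray the real parts of any two exponents differ by a nondegenerate leading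
  term, hence are comparable for large r.\<close>

lemma generic_ray:
  fixes J :: "complex poly set"
  assumes "finite J" "\<And>Q. Q \<in> J \<Longrightarrow> coeff Q 0 = 0" "Q0 \<in> J" "degree Q0 > 0"
  obtains \<theta> where "Re (lead_coeff Q0 * cis (real (degree Q0) * \<theta>)) > 0"
    "\<And>Q Q'. Q \<in> J \<Longrightarrow> Q' \<in> J \<Longrightarrow> Q \<noteq> Q' \<Longrightarrow>
       degree (Q - Q') > 0 \<and> Re (lead_coeff (Q - Q') * cis (real (degree (Q - Q')) * \<theta>)) \<noteq> 0"
proof -
  have deg: "degree (Q - Q') > 0" if "Q \<in> J" "Q' \<in> J" "Q \<noteq> Q'" for Q Q'
  proof (rule ccontr)
    assume "\<not> degree (Q - Q') > 0"
    then obtain a where a: "Q - Q' = [:a:]" by (metis degree_eq_zeroE neq0_conv)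
    then have "a = coeff (Q - Q') 0" by simp
    then have "a = 0" using assms(2) that by simp
    then show False using a that by simp
  qed
  define bad where "bad = (\<Union>(Q, Q') \<in> {(Q, Q') \<in> J \<times> J. Q \<noteq> Q'}. {\<theta>. Re (lead_coeff (Q - Q') * cis (real (degree (Q - Q')) * \<theta>)) = 0})"
  have "countable bad" unfolding bad_def
  proof (intro countable_UN)
    have "{(Q, Q') \<in> J \<times> J. Q \<noteq> Q'} \<subseteq> J \<times> J" by auto
    then show "countable {(Q, Q') \<in> J \<times> J. Q \<noteq> Q'}"
      using assms(1) by (meson countable_finite finite_SigmaI finite_subset)
    show "countable (case p of (Q, Q') \<Rightarrow> {\<theta>. Re (lead_coeff (Q - Q') * cis (real (degree (Q - Q')) * \<theta>)) = 0})"
      if p: "p \<in> {(Q, Q') \<in> J \<times> J. Q \<noteq> Q'}" for p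
    proof -
      obtain Q Q' where QQ: "p = (Q, Q')" "degree (Q - Q') > 0" using p deg by auto
      then have "lead_coeff (Q - Q') \<noteq> 0" by (metis degree_0 leading_coeff_0_iff less_irrefl)
      then show ?thesis unfolding QQ(1) prod.case using QQ(2) by (rule countable_degenerate_rays)
    qed
  qed
  define \<alpha> where "\<alpha> = Arg (lead_coeff Q0)"
  define d where "d = real (degree Q0)"
  have d: "d > 0" using assms by (simp add: d_def)
  \<comment> \<open>On this interval |alpha + d theta| < 1 < pi/2, so the cosine is positive; being
    uncountable, it is not exhausted by \<open>bad\<close>.\<close>
  have "(- \<alpha> - 1) / d < (- \<alpha> + 1) / d" using d by (simp add: divide_strict_right_mono)
  then have "\<not> countable {(- \<alpha> - 1) / d <..< (- \<alpha> + 1) / d}"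
    by (simp add: uncountable_open_interval)
  then obtain \<theta> where \<theta>: "\<theta> \<in> {(- \<alpha> - 1) / d <..< (- \<alpha> + 1) / d}" "\<theta> \<notin> bad"
    using \<open>countable bad\<close> by (meson countable_subset subsetI)
  have "\<bar>\<alpha> + d * \<theta>\<bar> < 1" using \<theta>(1) d by (auto simp: field_simps)
  then have "cos (\<alpha> + d * \<theta>) > 0"
    using pi_gt3 by (intro cos_gt_zero_pi) auto
  moreover have "Re (lead_coeff Q0 * cis (d * \<theta>)) = cmod (lead_coeff Q0) * cos (\<alpha> + d * \<theta>)"
  proof -
    have "Re (lead_coeff Q0 * cis (d * \<theta>)) = Re (rcis (cmod (lead_coeff Q0)) \<alpha> * cis (d * \<theta>))"
      by (simp add: rcis_cmod_Arg \<alpha>_def)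
    also have "\<dots> = cmod (lead_coeff Q0) * cos (\<alpha> + d * \<theta>)"
      by (simp add: rcis_def cis_mult mult.assoc)
    finally show ?thesis .
  qed
  moreover have "cmod (lead_coeff Q0) > 0" using assms(4) by (metis degree_0 leading_coeff_0_iff less_irrefl zero_less_norm_iff)
  ultimately have "Re (lead_coeff Q0 * cis (d * \<theta>)) > 0" by simp
  then show thesis using that[of \<theta>] deg \<theta>(2) unfolding bad_def d_def by auto
qed

lemma finite_has_dominating:
  assumes "finite J" "J \<noteq> {}"
    "\<And>x y. x \<in> J \<Longrightarrow> y \<in> J \<Longrightarrow> x \<noteq> y \<Longrightarrow> R x y \<or> R y x"
    "\<And>x y z. R x y \<Longrightarrow> R y z \<Longrightarrow> R x z"
  shows "\<exists>m\<in>J. \<forall>x\<in>J. x \<noteq> m \<longrightarrow> R m x"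
  using assms(1-3)
proof (induction J rule: finite_ne_induct)
  case (singleton x)
  then show ?case by simp
next
  case (insert b J)
  then obtain m where m: "m \<in> J" "\<forall>x\<in>J. x \<noteq> m \<longrightarrow> R m x" by auto
  have "R m b \<or> R b m" using insert m by (metis insertCI)
  then show ?case
  proof
    assume "R m b" then show ?thesis using m by auto
  next
    assume "R b m" then show ?thesis using m assms(4) by (metis insertE insertCI)
  qed
qed

text \<open>The exponent \<open>M\<close> that dominates on the ray may differ from
  \<open>Q0\<close>, but its real part is eventually at least that of \<open>Q0\<close>, which grows
  like r^d with d >= n.\<close>

lemma exponential_polynomial_large_on_ray:
  assumes A: "exponential_polynomial A" and ord: "growth_order A = ereal (real n)" and n: "n \<ge> 1"
  obtains \<theta> \<kappa> where "\<kappa> > 0" "eventually (\<lambda>r. exp (\<kappa> * r ^ n) \<le> cmod (A (of_real r * cis \<theta>))) at_top"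
proof -
  obtain J P where J: "finite J" "\<And>Q. Q \<in> J \<Longrightarrow> coeff Q 0 = 0" "\<And>Q. Q \<in> J \<Longrightarrow> P Q \<noteq> 0"
    and A_eq: "A = (\<lambda>z. \<Sum>Q\<in>J. poly (P Q) z * exp (poly Q z))"
    using exponential_polynomial_reduced[OF A] by blast
  define d where "d = Max (insert 0 (degree ` J))"
  have dle: "degree Q \<le> d" if "Q \<in> J" for Q
    using that J(1) unfolding d_def by (intro Max_ge) auto
  obtain C m where "C \<ge> 0" "\<And>z. cmod z \<ge> 1 \<Longrightarrow> cmod (A z) \<le> C * cmod z ^ m * exp (C * cmod z ^ d)"
    unfolding A_eq using norm_exp_sum_le[OF J(1) dle] by blast
  then have "growth_order A \<le> ereal (real d)" by (rule growth_order_le)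
  then have nd: "n \<le> d" using ord by simp
  then have "d > 0" using n by simp
  then obtain Q0 where Q0: "Q0 \<in> J" "degree Q0 = d"
    using Max_in[of "insert 0 (degree ` J)"] J(1) unfolding d_def by auto
  then obtain \<theta> where \<theta>: "Re (lead_coeff Q0 * cis (real (degree Q0) * \<theta>)) > 0"
    "\<And>Q Q'. Q \<in> J \<Longrightarrow> Q' \<in> J \<Longrightarrow> Q \<noteq> Q' \<Longrightarrow>
       degree (Q - Q') > 0 \<and> Re (lead_coeff (Q - Q') * cis (real (degree (Q - Q')) * \<theta>)) \<noteq> 0"
    using generic_ray[of J Q0] J \<open>d > 0\<close> by metis
  define q where "q = (\<lambda>Q r. Re (poly Q (of_real r * cis \<theta>)))"
  \<comment> \<open>A linear margin, not mere positivity: exp(-c r) then beats every polynomial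
    coefficient, and margins add up, which gives transitivity.\<close>
  define R where "R = (\<lambda>Q Q'. \<exists>c>0. eventually (\<lambda>r. q Q r - q Q' r \<ge> c * r) at_top)"
  have pos: "R Q Q'" if deg: "degree (Q - Q') > 0" and lead: "Re (lead_coeff (Q - Q') * cis (real (degree (Q - Q')) * \<theta>)) > 0" for Q Q'
  proof -
    obtain c where c: "c > 0" "eventually (\<lambda>r. Re (poly (Q - Q') (of_real r * cis \<theta>)) \<ge> c * r ^ degree (Q - Q')) at_top"
      using Re_poly_on_ray_ge[OF lead] by blast
    have "eventually (\<lambda>r. q Q r - q Q' r \<ge> c * r) at_top"
      using c(2) eventually_ge_at_top[of 1]
    proof eventually_elim
      case (elim r)
      have "r ^ 1 \<le> r ^ degree (Q - Q')" using elim that by (intro power_increasing) auto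
      then have "c * r \<le> c * r ^ degree (Q - Q')" using c by (intro mult_left_mono) auto
      then show ?case using elim by (simp add: q_def)
    qed
    then show ?thesis using c by (auto simp: R_def)
  qed
  have "\<exists>m\<in>J. \<forall>x\<in>J. x \<noteq> m \<longrightarrow> R m x"
  proof (rule finite_has_dominating)
    show "R Q Q' \<or> R Q' Q" if "Q \<in> J" "Q' \<in> J" "Q \<noteq> Q'" for Q Q'
    proof -
      have eq: "Q' - Q = - (Q - Q')" by simp
      have "Re (lead_coeff (Q' - Q) * cis (real (degree (Q' - Q)) * \<theta>)) = - Re (lead_coeff (Q - Q') * cis (real (degree (Q - Q')) * \<theta>))"
        unfolding eq degree_minus by (simp add: algebra_simps)
      moreover have "Re (lead_coeff (Q - Q') * cis (real (degree (Q - Q')) * \<theta>)) \<noteq> 0" "degree (Q - Q') > 0" "degree (Q' - Q) > 0"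
        using \<theta>(2)[of Q Q'] \<theta>(2)[of Q' Q] that by auto
      ultimately consider "Re (lead_coeff (Q - Q') * cis (real (degree (Q - Q')) * \<theta>)) > 0"
        | "Re (lead_coeff (Q' - Q) * cis (real (degree (Q' - Q)) * \<theta>)) > 0" by linarith
      then show ?thesis using pos \<open>degree (Q - Q') > 0\<close> \<open>degree (Q' - Q) > 0\<close> by cases blast+
    qed
    show "R x z" if "R x y" "R y z" for x y z
    proof -
      obtain c c' where c: "c > 0" "eventually (\<lambda>r. q x r - q y r \<ge> c * r) at_top"
        "c' > 0" "eventually (\<lambda>r. q y r - q z r \<ge> c' * r) at_top"
        using \<open>R x y\<close> \<open>R y z\<close> by (auto simp: R_def)
      have "eventually (\<lambda>r. q x r - q z r \<ge> (c + c') * r) at_top"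
        using c(2,4) by eventually_elim (simp add: algebra_simps)
      then show ?thesis using c(1,3) by (auto simp: R_def intro!: exI[of _ "c + c'"])
    qed
  qed (use J Q0 in auto)
  then obtain M where M: "M \<in> J" "\<And>Q. Q \<in> J \<Longrightarrow> Q \<noteq> M \<Longrightarrow> R M Q" by blast
  obtain c where c: "c > 0" "eventually (\<lambda>r. cmod (poly (P M) (of_real r * cis \<theta>)) \<ge> c) at_top"
    using norm_poly_on_ray_ge J(3) M(1) by metis
  have small: "((\<lambda>r. cmod (poly (P Q) (of_real r * cis \<theta>)) * exp (q Q r - q M r)) \<longlongrightarrow> 0) at_top"
    if Q: "Q \<in> J - {M}" for Q
  proof -
    have "R M Q" using M(2)[of Q] Q by auto
    then obtain b where b: "b > 0" "eventually (\<lambda>r. q M r - q Q r \<ge> b * r) at_top"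
      unfolding R_def by blast
    define k where "k = degree (P Q)"
    define a where "a = (\<Sum>i\<le>k. cmod (coeff (P Q) i))"
    have a: "a \<ge> 0" by (auto simp: a_def intro: sum_nonneg)
    have lim: "((\<lambda>r. a * r powr real k * exp (- b * r)) \<longlongrightarrow> 0) at_top"
      using b by real_asymp
    show ?thesis
    proof (rule tendsto_sandwich[OF _ _ tendsto_const lim])
      show "eventually (\<lambda>r. cmod (poly (P Q) (of_real r * cis \<theta>)) * exp (q Q r - q M r) \<le> a * r powr real k * exp (- b * r)) at_top"
        using b(2) eventually_ge_at_top[of 1]
      proof eventually_elim
        case (elim r)
        have "cmod (poly (P Q) (of_real r * cis \<theta>)) \<le> a * r ^ k"
          using norm_poly_le[of "P Q" k "of_real r * cis \<theta>"] elim by (simp add: a_def k_def norm_mult)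
        moreover have "exp (q Q r - q M r) \<le> exp (- b * r)" using elim by simp
        ultimately show ?case using elim a by (auto simp: powr_realpow intro!: mult_mono)
      qed
    qed auto
  qed
  have "((\<lambda>r. \<Sum>Q\<in>J - {M}. cmod (poly (P Q) (of_real r * cis \<theta>)) * exp (q Q r - q M r)) \<longlongrightarrow> 0) at_top"
    using small by (intro tendsto_null_sum) auto
  then have s: "eventually (\<lambda>r. (\<Sum>Q\<in>J - {M}. cmod (poly (P Q) (of_real r * cis \<theta>)) * exp (q Q r - q M r)) < c / 2) at_top"
    using c(1) by (intro order_tendstoD) auto
  have low: "eventually (\<lambda>r. c / 2 * exp (q M r) \<le> cmod (A (of_real r * cis \<theta>))) at_top"
    using s c(2)
  proof eventually_elim
    case (elim r)
    define z where "z = of_real r * cis \<theta>"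
    define S where "S = (\<Sum>Q\<in>J - {M}. poly (P Q) z * exp (poly Q z))"
    have "A z = poly (P M) z * exp (poly M z) + S"
      unfolding A_eq S_def using J(1) M(1) by (simp add: sum.remove)
    then have "cmod (A z) \<ge> cmod (poly (P M) z * exp (poly M z)) - cmod S"
      using norm_diff_ineq[of "poly (P M) z * exp (poly M z)" S] by simp
    moreover have "cmod (poly (P M) z * exp (poly M z)) \<ge> c * exp (q M r)"
      using elim by (simp add: norm_mult q_def z_def)
    moreover have "cmod S \<le> c / 2 * exp (q M r)"
    proof -
      have "cmod S \<le> (\<Sum>Q\<in>J - {M}. cmod (poly (P Q) z) * exp (q Q r))"
        unfolding S_def by (rule order.trans[OF norm_sum]) (simp add: norm_mult q_def z_def)
      also have "\<dots> = (\<Sum>Q\<in>J - {M}. cmod (poly (P Q) z) * exp (q Q r - q M r)) * exp (q M r)"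
        unfolding sum_distrib_right mult.assoc by (simp flip: exp_add)
      also have "\<dots> \<le> c / 2 * exp (q M r)" using elim by (intro mult_right_mono) (auto simp: z_def)
      finally show ?thesis .
    qed
    ultimately show ?case by (simp add: z_def)
  qed
  obtain l where l: "l > 0" "eventually (\<lambda>r. q Q0 r \<ge> l * r ^ d) at_top"
    using Re_poly_on_ray_ge[OF \<theta>(1)] Q0(2) unfolding q_def by auto
  have "eventually (\<lambda>r. q M r \<ge> q Q0 r) at_top"
  proof (cases "M = Q0")
    case False
    then obtain b where b: "b > 0" "eventually (\<lambda>r. q M r - q Q0 r \<ge> b * r) at_top"
      using M(2)[of Q0] Q0 by (auto simp: R_def)
    show ?thesis using b(2) eventually_ge_at_top[of 0]
    proof eventually_elim
      case (elim r)
      have "b * r \<ge> 0" using b elim by simp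
      then show ?case using elim by simp
    qed
  qed simp
  \<comment> \<open>The constant c/2 is paid for with half of the exponent: r <= r^d gives l r^d -
    (l/2) r >= (l/2) r^n.\<close>
  moreover have "eventually (\<lambda>r::real. c / 2 \<ge> exp (- (l / 2) * r)) at_top"
    using c(1) l(1) by real_asymp
  ultimately have "eventually (\<lambda>r. exp (l / 2 * r ^ n) \<le> cmod (A (of_real r * cis \<theta>))) at_top"
    using low l(2) eventually_ge_at_top[of 1]
  proof eventually_elim
    case (elim r)
    have "r ^ n \<le> r ^ d" "r \<le> r ^ d"
      using elim nd n by (auto intro!: power_increasing self_le_power)
    then have "l / 2 * r ^ n \<le> l / 2 * r ^ d" "l / 2 * r \<le> l / 2 * r ^ d" using l by (auto intro!: mult_left_mono)
    then have "l / 2 * r ^ n \<le> - (l / 2) * r + l * r ^ d"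
      by (simp add: algebra_simps)
    then have "exp (l / 2 * r ^ n) \<le> exp (- (l / 2) * r) * exp (l * r ^ d)"
      by (simp flip: exp_add)
    also have "\<dots> \<le> c / 2 * exp (q M r)" using elim c(1) by (intro mult_mono) auto
    finally show ?case using elim by simp
  qed
  then show thesis using that[of "l / 2"] l by simp
qed

section \<open>Counting zeros\<close>

lemma exponential_polynomial_holomorphic:
  assumes "exponential_polynomial A"
  shows "A holomorphic_on UNIV"
  using assms unfolding exponential_polynomial_def by (auto intro!: holomorphic_intros)

lemma growth_order_bound:
  assumes A: "A holomorphic_on UNIV" and a: "growth_order A < ereal a"
  shows "eventually (\<lambda>r. \<forall>z. cmod z \<le> r \<longrightarrow> cmod (A z) \<le> exp (r powr a)) at_top"
proof -
  have "eventually (\<lambda>r. ereal (log_plus (log_plus (max_modulus A r)) / ln r) < ereal a) at_top"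
    using a unfolding growth_order_def by (rule Limsup_lessD)
  then show ?thesis using eventually_gt_at_top[of 1]
  proof eventually_elim
    case (elim r)
    then have M: "max_modulus A r \<le> exp (r powr a)"
      by (intro log_log_quotient_less_imp) auto
    have "bdd_above ((\<lambda>z. cmod (A z)) ` sphere 0 r)"
      using A by (intro compact_imp_bounded[THEN bounded_imp_bdd_above] compact_continuous_image continuous_intros
          holomorphic_on_imp_continuous_on) (auto intro: holomorphic_on_subset)
    then have bd: "cmod (A w) \<le> max_modulus A r" if "cmod (w - 0) = r" for w
      unfolding max_modulus_def using that by (intro cSUP_upper) (auto simp: dist_norm)
    have sph: "cmod (A w) \<le> exp (r powr a)" if "cmod (w - 0) = r" for w
      using bd[OF that] M by (rule order.trans)
    have "cmod (A z) \<le> exp (r powr a)" if "cmod z \<le> r" for z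
      using norm_le_on_disc[of A 0 r "exp (r powr a)" z] sph A that elim
      by (auto intro: holomorphic_on_subset)
    then show ?case by blast
  qed
qed

lemma zorder_solution_zero:
  assumes "ode_solution A f" "continuous_on UNIV A" "f z0 \<noteq> 0" "f a = 0"
  shows "zorder f a = 1"
  using assms solution_zero_simple[OF assms]
  by (intro zorder_zero_eqI[of f UNIV]) (auto simp: ode_solution_def)

lemma zero_count_solution:
  assumes "ode_solution A f" "continuous_on UNIV A" "f z0 \<noteq> 0"
  shows "zero_count S f r = card {z \<in> S. cmod z \<le> r \<and> f z = 0}"
proof -
  have "zero_count S f r = (\<Sum>z\<in>{z \<in> S. cmod z \<le> r \<and> f z = 0}. 1)"
    unfolding zero_count_def using zorder_solution_zero[OF assms] by (intro sum.cong) auto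
  then show ?thesis by simp
qed

text \<open>Each cell of a square grid of side s/2 contains at most one zero. The bound on
  \<open>A\<close> is required up to \<open>r + 1\<close> because the separation lemma uses a disc
  of radius s <= 1 about a zero.\<close>

lemma card_solution_zeros_le:
  assumes sol: "ode_solution A f" and A: "continuous_on UNIV A" and nz: "f z0 \<noteq> 0"
    and K: "\<And>w. cmod w \<le> r + 1 \<Longrightarrow> cmod (A w) \<le> K" and Ks: "K * s\<^sup>2 \<le> 1/16"
    and s: "0 < s" "s \<le> 1" and r: "0 \<le> r"
  shows "finite {z. cmod z \<le> r \<and> f z = 0}" "real (card {z. cmod z \<le> r \<and> f z = 0}) \<le> (4 * r / s + 3)\<^sup>2"
proof -
  define Z where "Z = {z. cmod z \<le> r \<and> f z = 0}"
  \<comment> \<open>With side s/2, two points of one cell satisfy |Re| + |Im| < s for their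
    difference, hence are at distance less than s.\<close>
  define \<phi> where "\<phi> = (\<lambda>z. (\<lfloor>Re z / (s/2)\<rfloor>, \<lfloor>Im z / (s/2)\<rfloor>))"
  define m where "m = \<lceil>2 * r / s\<rceil>"
  have "0 \<le> 2 * r / s" using r s by simp
  then have m0: "m \<ge> 0" unfolding m_def by linarith
  have sep: "\<bar>x - y\<bar> < s / 2" if "\<lfloor>x / (s/2)\<rfloor> = \<lfloor>y / (s/2)\<rfloor>" for x y :: real
  proof -
    define u where "u = x / (s/2) - y / (s/2)"
    have u: "\<bar>u\<bar> < 1" unfolding u_def using that by linarith
    have xy: "x - y = u * (s/2)" using s by (simp add: u_def field_simps)
    have "\<bar>x - y\<bar> = \<bar>u\<bar> * (s/2)" unfolding xy using s by (simp add: abs_mult)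
    also have "\<dots> < 1 * (s/2)" using u s by (intro mult_strict_right_mono) auto
    finally show ?thesis by simp
  qed
  have inj: "inj_on \<phi> Z"
  proof (rule inj_onI)
    fix a b assume ab: "a \<in> Z" "b \<in> Z" "\<phi> a = \<phi> b"
    have "\<bar>Re b - Re a\<bar> < s / 2" "\<bar>Im b - Im a\<bar> < s / 2"
      using ab(3) sep[of "Re b" "Re a"] sep[of "Im b" "Im a"] by (auto simp: \<phi>_def)
    then have "cmod (b - a) \<le> s" using cmod_le[of "b - a"] by simp
    moreover have "cmod (A w) \<le> K" if "w \<in> cball a s" for w
    proof (rule K)
      have "cmod w \<le> cmod a + cmod (w - a)" by (rule norm_triangle_sub)
      then show "cmod w \<le> r + 1" using that ab(1) s by (simp add: Z_def dist_norm norm_minus_commute)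
    qed
    ultimately show "a = b"
      using solution_zeros_separated[OF sol A nz _ Ks] ab(1,2) by (auto simp: Z_def)
  qed
  have im: "\<phi> ` Z \<subseteq> {-m..m} \<times> {-m..m}"
  proof -
    have fl: "\<lfloor>x / (s/2)\<rfloor> \<in> {-m..m}" if "\<bar>x\<bar> \<le> r" for x
    proof -
      have "\<bar>x / (s/2)\<bar> \<le> 2 * r / s" using that s by (simp add: abs_divide abs_mult divide_right_mono)
      then have "\<bar>x / (s/2)\<bar> \<le> of_int m" unfolding m_def by linarith
      then have "- of_int m \<le> x / (s/2)" "x / (s/2) \<le> of_int m" by linarith+
      then show ?thesis by (simp only: atLeastAtMost_iff) linarith
    qed
    have "\<bar>Re z\<bar> \<le> r" "\<bar>Im z\<bar> \<le> r" if "z \<in> Z" for z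
      using abs_Re_le_cmod[of z] abs_Im_le_cmod[of z] that by (auto simp: Z_def)
    then show ?thesis using fl by (auto simp: \<phi>_def)
  qed
  have "finite (\<phi> ` Z)" using im by (rule finite_subset) auto
  then show "finite {z. cmod z \<le> r \<and> f z = 0}" using inj by (simp add: Z_def[symmetric] finite_image_iff)
  have "card Z = card (\<phi> ` Z)" using inj by (simp add: card_image)
  also have "\<dots> \<le> card ({-m..m} \<times> {-m..m})" using im by (intro card_mono) auto
  also have "\<dots> = (nat (2 * m + 1))\<^sup>2" by (simp add: card_cartesian_product power2_eq_square)
  finally have "real (card Z) \<le> real ((nat (2 * m + 1))\<^sup>2)" by (rule of_nat_mono)
  also have "\<dots> = (2 * of_int m + 1)\<^sup>2" using m0 by simp
  also have "\<dots> \<le> (4 * r / s + 3)\<^sup>2"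
  proof (rule power_mono)
    have "of_int m \<le> 2 * r / s + 1" unfolding m_def by linarith
    then show "2 * of_int m + 1 \<le> 4 * r / s + 3" by simp
  qed (use m0 in auto)
  finally show "real (card {z. cmod z \<le> r \<and> f z = 0}) \<le> (4 * r / s + 3)\<^sup>2" by (simp add: Z_def)
qed

text \<open>With mesh proportional to the inverse square root of exp((r+1)^a), the count is at most
  a quadratic factor in r times that exponential.\<close>

lemma hyper_exponent_le:
  assumes sol: "ode_solution A f" and A: "A holomorphic_on UNIV" and nz: "f z0 \<noteq> 0"
    and ord: "growth_order A = ereal b" and b: "b \<ge> 0"
  shows "hyper_exponent S f \<le> ereal b"
proof (rule ereal_le_epsilon2)
  fix \<eta> :: real assume \<eta>: "\<eta> > 0"
  have cont: "continuous_on UNIV A" using A by (rule holomorphic_on_imp_continuous_on)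
  \<comment> \<open>The other half of eta absorbs the quadratic factor and the shift from r to r +
    1.\<close>
  define a where "a = b + \<eta> / 2"
  have a: "a > 0" "growth_order A < ereal a" using b \<eta> ord by (auto simp: a_def)
  have ev: "eventually (\<lambda>r. \<forall>z. cmod z \<le> r + 1 \<longrightarrow> cmod (A z) \<le> exp ((r + 1) powr a)) at_top"
    using growth_order_bound[OF A a(2)]
    by (rule eventually_compose_filterlim) real_asymp
  have asym: "eventually (\<lambda>r. (16 * r * exp ((r + 1) powr a / 2) + 3)\<^sup>2 \<le> exp (r powr (b + \<eta>))) at_top"
  proof -
    have "b + \<eta> = a + \<eta> / 2" by (simp add: a_def)
    then have "eventually (\<lambda>r. 2 * ln (19 * r) + (r + 1) powr a \<le> r powr (b + \<eta>)) at_top"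
      using a(1) \<eta> by (simp only:) real_asymp
    then show ?thesis using eventually_ge_at_top[of 1]
    proof eventually_elim
      case (elim r)
      have "1 \<le> r * exp ((r + 1) powr a / 2)"
        using elim mult_mono[of 1 r 1 "exp ((r + 1) powr a / 2)"] by simp
      then have "(16 * r * exp ((r + 1) powr a / 2) + 3)\<^sup>2 \<le> (19 * r * exp ((r + 1) powr a / 2))\<^sup>2"
        using elim by (intro power_mono) auto
      also have "\<dots> = (exp (ln (19 * r)) * exp ((r + 1) powr a / 2))\<^sup>2" using elim by simp
      also have "\<dots> = exp (2 * ln (19 * r) + (r + 1) powr a)"
        unfolding exp_add[symmetric] exp_double[symmetric] by (simp add: algebra_simps)
      also have "\<dots> \<le> exp (r powr (b + \<eta>))" using elim by simp
      finally show ?case .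
    qed
  qed
  have "eventually (\<lambda>r. ereal (log_plus (log_plus (real (zero_count S f r))) / ln r) \<le> ereal (b + \<eta>)) at_top"
    using ev asym eventually_gt_at_top[of 1]
  proof eventually_elim
    case (elim r)
    define E where "E = exp ((r + 1) powr a / 2)"
    have E: "E \<ge> 1" "exp ((r + 1) powr a) = E\<^sup>2" by (auto simp: E_def simp flip: exp_double)
    have "exp ((r + 1) powr a) * (1 / (4 * E))\<^sup>2 \<le> 1/16" using E by (simp add: power_divide power_mult_distrib)
    then have Z: "finite {z. cmod z \<le> r \<and> f z = 0}" "real (card {z. cmod z \<le> r \<and> f z = 0}) \<le> (4 * r / (1 / (4 * E)) + 3)\<^sup>2"
      using card_solution_zeros_le[OF sol cont nz, of r "exp ((r + 1) powr a)" "1 / (4 * E)"] elim E by auto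
    have "zero_count S f r = card {z \<in> S. cmod z \<le> r \<and> f z = 0}"
      by (rule zero_count_solution[OF sol cont nz])
    also have "\<dots> \<le> card {z. cmod z \<le> r \<and> f z = 0}" using Z by (intro card_mono) auto
    finally have "real (zero_count S f r) \<le> (4 * r / (1 / (4 * E)) + 3)\<^sup>2" using Z by linarith
    also have "\<dots> = (16 * r * exp ((r + 1) powr a / 2) + 3)\<^sup>2" by (simp add: E_def mult.assoc)
    finally have "real (zero_count S f r) \<le> exp (r powr (b + \<eta>))" using elim by simp
    then show ?case using elim b \<eta> by (simp add: log_log_quotient_le)
  qed
  then have "hyper_exponent S f \<le> ereal (b + \<eta>)"
    unfolding hyper_exponent_def by (rule Limsup_bounded)
  then show "hyper_exponent S f \<le> ereal b + ereal \<eta>" by simp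
qed

lemma hyper_exponent_bound:
  assumes "hyper_exponent S f < ereal a"
  shows "eventually (\<lambda>r. real (zero_count S f r) \<le> exp (r powr a)) at_top"
proof -
  have "eventually (\<lambda>r. ereal (log_plus (log_plus (real (zero_count S f r))) / ln r) < ereal a) at_top"
    using assms unfolding hyper_exponent_def by (rule Limsup_lessD)
  then show ?thesis using eventually_gt_at_top[of 1]
    by eventually_elim (intro log_log_quotient_less_imp, auto)
qed

text \<open>A limsup yields only arbitrarily large r, which is enough against an upper bound valid
  for all large R.\<close>

lemma PL_indicator_frequently_large:
  assumes "PL_indicator n A \<theta> > ereal \<kappa>"
  shows "frequently (\<lambda>r. exp (\<kappa> * r ^ n) \<le> cmod (A (of_real r * cis \<theta>))) at_top"
proof (rule ccontr)
  assume "\<not> ?thesis"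
  then have "eventually (\<lambda>r. cmod (A (of_real r * cis \<theta>)) < exp (\<kappa> * r ^ n)) at_top"
    by (simp add: frequently_def not_le)
  then have "eventually (\<lambda>r. ereal (1 / r ^ n) * log_ext (cmod (A (of_real r * cis \<theta>))) \<le> ereal \<kappa>) at_top"
    using eventually_gt_at_top[of 0]
  proof eventually_elim
    case (elim r)
    define x where "x = cmod (A (of_real r * cis \<theta>))"
    show ?case
    proof (cases "x \<le> 0")
      case True
      then show ?thesis using elim by (simp add: log_ext_def x_def[symmetric])
    next
      case False
      then have "ln x < ln (exp (\<kappa> * r ^ n))" using elim by (subst ln_less_cancel_iff) (auto simp: x_def)
      then have "ln x / r ^ n \<le> \<kappa>" using elim by (simp add: divide_le_eq)
      then show ?thesis using False by (simp add: log_ext_def x_def[symmetric])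
    qed
  qed
  then have "PL_indicator n A \<theta> \<le> ereal \<kappa>"
    unfolding PL_indicator_def by (rule Limsup_bounded)
  then show False using assms by simp
qed

lemma PL_indicator_ge:
  assumes "eventually (\<lambda>r. exp (\<kappa> * r ^ n) \<le> cmod (A (of_real r * cis \<theta>))) at_top"
  shows "ereal \<kappa> \<le> PL_indicator n A \<theta>"
  unfolding PL_indicator_def
proof (rule le_Limsup)
  show "eventually (\<lambda>r. ereal \<kappa> \<le> ereal (1 / r ^ n) * log_ext (cmod (A (of_real r * cis \<theta>)))) at_top"
    using assms eventually_gt_at_top[of 0]
  proof eventually_elim
    case (elim r)
    define x where "x = cmod (A (of_real r * cis \<theta>))"
    have x: "exp (\<kappa> * r ^ n) \<le> x" using elim by (simp add: x_def)
    then have x0: "x > 0" by (smt (verit) exp_gt_zero)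
    then have "\<kappa> * r ^ n \<le> ln x" using x by (simp add: ln_ge_iff)
    then have "\<kappa> \<le> ln x / r ^ n" using elim by (simp add: pos_le_divide_eq)
    then show ?case using x0 by (simp add: log_ext_def x_def[symmetric])
  qed
qed simp

section \<open>Growth along a ray\<close>

text \<open>The quantitative core, for one fixed R. \<open>N\<close> may enter polynomially but
  \<open>d\<close> only through the logarithms in \<open>M\<close>; \<open>t0\<close> and
  \<open>P0\<close> are meant to stay fixed as R grows, with \<open>k\<close> logarithmic in
  R.\<close>

lemma ray_estimate:
  fixes f :: "nat \<Rightarrow> complex \<Rightarrow> complex" and A :: "complex \<Rightarrow> complex" and e :: complex
    and Z S :: "complex set" and w0 c t0 R K d P0 :: real and k :: nat
  assumes A: "A holomorphic_on UNIV"
    and sol: "\<And>i. i < 3 \<Longrightarrow> ode_solution A (f i)"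
    and wr: "\<And>i j z. i < 3 \<Longrightarrow> j < 3 \<Longrightarrow> i \<noteq> j \<Longrightarrow> w0 \<le> cmod (f i z * deriv (f j) z - deriv (f i) z * f j z)"
    and w0: "0 < w0" "w0 \<le> 1" and e: "cmod e = 1" and c: "0 < c" "c \<le> 1"
    and t0: "40 \<le> c * t0" and R: "t0 \<le> R"
    and S: "\<And>t z. t0 \<le> t \<Longrightarrow> cmod (z - of_real t * e) < c * t \<Longrightarrow> z \<in> S"
    and Z: "Z = {z \<in> S. cmod z \<le> 2 * R \<and> (\<exists>i<3. f i z = 0)}" and fin: "finite Z"
    and K: "\<And>w. cmod w \<le> 3 * R \<Longrightarrow> cmod (A w) \<le> K"
    and d: "0 < d" "K * d\<^sup>2 \<le> 1/16" "(2 * real (card Z) + 1) * d \<le> 1"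
    and P0: "1 \<le> P0" "\<And>z. cmod (z - of_real t0 * e) \<le> 1 \<Longrightarrow> cmod (f 0 z * f 1 z * f 2 z) \<le> P0"
    and k: "R \<le> t0 * (1 + c/4) ^ k"
  defines "N \<equiv> real (card Z)"
  defines "M \<equiv> 3 ^ k * (ln P0 + 3 * N * ln (4 * R / d) + 2 * ln (4 / (w0 * d)))"
  shows "cmod (A (of_real R * e)) \<le> 2 * (15 * M + (2 * N + 1) ^ 3)\<^sup>2"
proof -
  have N0: "N \<ge> 0" by (simp add: N_def)
  have t0': "t0 \<ge> 40"
  proof (rule ccontr)
    assume "\<not> 40 \<le> t0"
    then have "c * t0 < c * 40" using c by simp
    moreover have "c * 40 \<le> 40" using c by simp
    ultimately show False using t0 by linarith
  qed
  have R40: "R \<ge> 40" using t0' R by simp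
  have d1: "d \<le> 1"
  proof -
    have "1 * d \<le> (2 * real (card Z) + 1) * d" using d(1) by (intro mult_right_mono) auto
    then show ?thesis using d(3) by simp
  qed
  \<comment> \<open>The bound of \<open>solution_pair_lower_bound\<close> for |f_i f_j| at points at
    distance d from all zeros.\<close>
  define m0 where "m0 = w0 * d / 4"
  have m0: "0 < m0" "m0 \<le> 1"
    using w0 d(1) d1 mult_mono[of w0 1 d 1] by (auto simp: m0_def)
  define X where "X = 2 * ln (4 / (w0 * d))"
  have X_m0: "X = - (2 * ln m0)"
    using w0 d(1) by (simp add: X_def m0_def ln_div ln_mult)
  have expX: "exp (- X) = m0\<^sup>2"
    using m0 by (simp add: X_m0 exp_double)
  have X0: "X \<ge> 0" using m0 by (simp add: X_m0)
  define good where "good = (\<lambda>w. \<forall>a\<in>Z. d \<le> cmod (w - a))"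
  have ct: "c * t \<ge> 40" if "t0 \<le> t" for t
    using t0 mult_left_mono[OF that, of c] c by linarith
  have norm_te: "cmod (of_real t * e) = t" if "t0 \<le> t" for t
    using that t0' e by (simp add: norm_mult)
  have region: "z \<in> S" "cmod z \<le> 2 * R" if "t0 \<le> t" "t \<le> R" "cmod (z - of_real t * e) < c * t" for t z
  proof -
    show "z \<in> S" using S that by blast
    have "cmod z \<le> cmod (of_real t * e) + cmod (z - of_real t * e)"
      by (metis norm_triangle_sub)
    also have "\<dots> \<le> t + c * t" using that norm_te by simp
    also have "c * t \<le> 1 * t" using that c t0' by (intro mult_right_mono) auto
    finally show "cmod z \<le> 2 * R" using that by simp
  qed
  have circle: "\<exists>s. d \<le> s \<and> s \<le> 1 \<and> (\<forall>w. cmod (w - z) = s \<longrightarrow> good w)" for z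
  proof -
    obtain s where s: "d \<le> s" "s \<le> (2 * real (card Z) + 1) * d"
      "\<And>w a. cmod (w - z) = s \<Longrightarrow> a \<in> Z \<Longrightarrow> d \<le> cmod (w - a)"
      using circle_avoiding_finite_set[OF fin d(1), of z] by metis
    then show ?thesis using d(3) by (intro exI[of _ s]) (auto simp: good_def)
  qed
  define Zi where "Zi = (\<lambda>i. {z \<in> Z. f i z = 0})"
  have Zi: "finite (Zi i)" "card (Zi i) \<le> card Z" for i
    using fin by (auto simp: Zi_def intro: card_mono)
  \<comment> \<open>For |z| <= 2R and a zero a in \<open>Z\<close> one has |z - a| <= 4R, so with
    this scale |B| <= 1.\<close>
  define B where "B = (\<lambda>i z. \<Prod>a\<in>Zi i. (z - a) / of_real (4 * R))"
  have "\<exists>g. i < 3 \<longrightarrow> g holomorphic_on UNIV \<and> (\<forall>z. f i z = B i z * g z) \<and> (\<forall>a\<in>Zi i. g a \<noteq> 0)" for i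
  proof (cases "i < 3")
    case i: True
    have "\<exists>g. g holomorphic_on UNIV \<and> (\<forall>z. f i z = B i z * g z) \<and> (\<forall>a\<in>Zi i. g a \<noteq> 0)"
      unfolding B_def
    proof (rule divide_simple_zeros)
      show "f i holomorphic_on UNIV" using sol[OF i] by (simp add: ode_solution_def)
      show "deriv (f i) a \<noteq> 0" if "a \<in> Zi i" for a
      proof
        assume "deriv (f i) a = 0"
        define j where "j = (if i = 0 then 1 else 0 :: nat)"
        have "w0 \<le> cmod (f i a * deriv (f j) a - deriv (f i) a * f j a)"
          using i by (intro wr) (auto simp: j_def)
        then show False using that \<open>deriv (f i) a = 0\<close> w0 by (simp add: Zi_def)
      qed
    qed (use Zi R40 in \<open>auto simp: Zi_def\<close>)
    then show ?thesis by blast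
  qed auto
  then obtain G where G: "\<And>i. i < 3 \<Longrightarrow> G i holomorphic_on UNIV" "\<And>i z. i < 3 \<Longrightarrow> f i z = B i z * G i z"
    "\<And>i a. i < 3 \<Longrightarrow> a \<in> Zi i \<Longrightarrow> G i a \<noteq> 0" by metis
  have G_cont: "continuous_on T (G i)" "G i holomorphic_on T" if "i < 3" for i T
    using G(1)[OF that] by (auto intro: holomorphic_on_subset holomorphic_on_imp_continuous_on)
  have B_le: "cmod (B i z) \<le> 1" if "cmod z \<le> 2 * R" for i z
  proof -
    have "cmod ((z - a) / of_real (4 * R)) \<le> 1" if "a \<in> Zi i" for a
    proof -
      have "cmod (z - a) \<le> 4 * R"
        using norm_triangle_ineq4[of z a] \<open>cmod z \<le> 2 * R\<close> that by (auto simp: Zi_def Z)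
      then show ?thesis using R40 by (simp add: norm_divide)
    qed
    then show ?thesis unfolding B_def by (simp add: prod_norm[symmetric] prod_le_1)
  qed
  have dR: "0 < d / (4 * R)" "d / (4 * R) \<le> 1" using d(1) d1 R40 by auto
  have B_ge: "(d / (4 * R)) ^ card Z \<le> cmod (B i w)" if "good w" for i w
  proof -
    have "(d / (4 * R)) ^ card Z \<le> (d / (4 * R)) ^ card (Zi i)"
      using dR Zi by (intro power_decreasing) auto
    also have "\<dots> = (\<Prod>a\<in>Zi i. d / (4 * R))" by simp
    also have "\<dots> \<le> (\<Prod>a\<in>Zi i. cmod ((w - a) / of_real (4 * R)))"
    proof (rule prod_mono)
      fix a assume "a \<in> Zi i"
      then have "d \<le> cmod (w - a)" using that by (auto simp: good_def Zi_def)
      then show "0 \<le> d / (4 * R) \<and> d / (4 * R) \<le> cmod ((w - a) / of_real (4 * R))"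
        using dR R40 by (simp add: norm_divide divide_right_mono)
    qed
    finally show ?thesis by (simp add: B_def prod_norm)
  qed
  have G_nz: "G i z \<noteq> 0" if i: "i < 3" and "t0 \<le> t" "t \<le> R" "cmod (z - of_real t * e) < c * t" for i t z
  proof
    assume "G i z = 0"
    then have "f i z = 0" using G(2)[OF i] by simp
    then have "z \<in> Zi i" using region[OF that(2-4)] i by (auto simp: Zi_def Z)
    then show False using G(3)[OF i] \<open>G i z = 0\<close> by blast
  qed
  \<comment> \<open>The margin 1 >= d keeps the d-disc about \<open>w\<close> in the region where
    every zero belongs to \<open>Z\<close>; as \<open>w\<close> is good, that disc is
    zero-free.\<close>
  have pair: "m0 \<le> cmod (f i w * f j w)"
    if t: "t0 \<le> t" "t \<le> R" "cmod (w - of_real t * e) < c * t - 1" and w: "good w" and ij: "i < 3" "j < 3" "i \<noteq> j" for i j t w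
  proof -
    have w2: "cmod w \<le> 2 * R" using region(2)[of t w] t by simp
    have nz: "f l x \<noteq> 0" if "cmod (x - w) < d" "l < 3" for l x
    proof
      assume "f l x = 0"
      have "cmod (x - of_real t * e) \<le> cmod (x - w) + cmod (w - of_real t * e)"
        using norm_triangle_ineq[of "x - w" "w - of_real t * e"] by simp
      also have "\<dots> < c * t" using that d1 t by linarith
      finally have "x \<in> Z" using region[of t x] t \<open>f l x = 0\<close> that by (auto simp: Z)
      then show False using w that by (auto simp: good_def norm_minus_commute)
    qed
    have "w0 * d / 4 \<le> cmod (f i w * deriv (f j) w - deriv (f i) w * f j w) * d / 4"
      using wr[OF ij] d by (intro divide_right_mono mult_right_mono) auto
    also have "\<dots> \<le> cmod (f i w * f j w)"
    proof (rule solution_pair_lower_bound[of A _ _ _ _ K])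
      show "cmod (A x) \<le> K" if "x \<in> cball w d" for x
      proof (rule K)
        have "cmod x \<le> cmod w + cmod (x - w)" by (rule norm_triangle_sub)
        then show "cmod x \<le> 3 * R" using that w2 d1 R40 by (simp add: dist_norm norm_minus_commute)
      qed
    qed (use sol ij d nz in auto)
    finally show ?thesis by (simp add: m0_def)
  qed
  define P where "P = (\<lambda>z. f 0 z * f 1 z * f 2 z)"
  define GP where "GP = (\<lambda>z. G 0 z * G 1 z * G 2 z)"
  have GP_hol: "GP holomorphic_on T" for T
    unfolding GP_def using G_cont(2) by (intro holomorphic_intros) auto
  have P_eq: "P z = B 0 z * B 1 z * B 2 z * GP z" for z
    using G(2)[of 0 z] G(2)[of 1 z] G(2)[of 2 z] by (simp add: P_def GP_def mult_ac)
  have P_le_GP: "cmod (P z) \<le> cmod (GP z)" if "cmod z \<le> 2 * R" for z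
  proof -
    have "cmod (B 0 z) * cmod (B 1 z) \<le> 1"
      using B_le[OF that] by (intro mult_le_one) auto
    then have "cmod (B 0 z) * cmod (B 1 z) * cmod (B 2 z) \<le> 1"
      using B_le[OF that] by (intro mult_le_one) auto
    then have "cmod (B 0 z * B 1 z * B 2 z) * cmod (GP z) \<le> 1 * cmod (GP z)"
      by (intro mult_right_mono) (auto simp: norm_mult)
    then show ?thesis by (simp add: P_eq norm_mult)
  qed
  \<comment> \<open>The product of the three pairwise bounds is |P|^2 >= m0^3 >= m0^4, since m0 <=
    1. This explains the factor 2 in \<open>X\<close>.\<close>
  have P_low: "m0\<^sup>2 \<le> cmod (P w)"
    if t: "t0 \<le> t" "t \<le> R" "cmod (w - of_real t * e) < c * t - 1" and w: "good w" for t w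
  proof -
    note p = pair[OF t w]
    have "m0 * m0 * m0 \<le> cmod (f 0 w * f 1 w) * cmod (f 1 w * f 2 w) * cmod (f 0 w * f 2 w)"
      using m0 by (intro mult_mono p) auto
    also have "\<dots> = (cmod (P w))\<^sup>2" by (simp add: P_def norm_mult power2_eq_square)
    finally have "m0 * m0 * m0 \<le> (cmod (P w))\<^sup>2" .
    moreover have "m0 * (m0 * m0 * m0) \<le> 1 * (m0 * m0 * m0)" using m0 by (intro mult_right_mono) auto
    ultimately have "(m0\<^sup>2)\<^sup>2 \<le> (cmod (P w))\<^sup>2" by (simp add: power2_eq_square mult_ac)
    then show ?thesis by (rule power2_le_imp_le) simp
  qed
  \<comment> \<open>A point near a zero is enclosed by a good circle of radius at most 1. There |GP|
    >= |P| >= m0^2, and the minimum principle carries this inside because \<open>GP\<close> has no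
    zeros. Halving the aperture leaves room for the circle: c t/2 + 1 < c t - 1, as c t >=
    40.\<close>
  have GP_low: "exp (- X) \<le> cmod (GP z)" if t: "t0 \<le> t" "t \<le> R" "cmod (z - of_real t * e) < c/2 * t" for t z
  proof -
    obtain s where s: "d \<le> s" "s \<le> 1" "\<And>w. cmod (w - z) = s \<Longrightarrow> good w" using circle by blast
    have near: "cmod (w - of_real t * e) < c * t - 1" if "cmod (w - z) \<le> s" for w
      using norm_triangle_ineq[of "w - z" "z - of_real t * e"] that t s ct[OF t(1)] by (simp add: algebra_simps)
    show ?thesis unfolding expX
    proof (rule norm_ge_on_disc[of GP z s])
      show "GP w \<noteq> 0" if "w \<in> cball z s" for w
      proof -
        have "cmod (w - of_real t * e) < c * t"
          using near[of w] that by (simp add: dist_norm norm_minus_commute)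
        then show ?thesis using G_nz t by (simp add: GP_def)
      qed
      show "m0\<^sup>2 \<le> cmod (GP w)" if "cmod (w - z) = s" for w
        using P_low[OF t(1,2) near] P_le_GP[of w] region(2)[OF t(1,2), of w] near[of w] s(3)[of w] that by force
    qed (use GP_hol s d m0 in auto)
  qed
  have logP0: "ln P0 \<ge> 0" using P0 by simp
  have log4: "ln (4 * R / d) \<ge> 0" using R40 d(1) d1 by simp
  \<comment> \<open>The starting value of the chain: on a good circle |P| <= P0 and each |B_i| is at
    least (d/(4R))^N; the maximum principle transfers the resulting bound for \<open>GP\<close> to
    the centre.\<close>
  have base: "ln (cmod (GP (of_real t0 * e))) \<le> ln P0 + 3 * N * ln (4 * R / d)"
  proof -
    define z where "z = of_real t0 * e"
    obtain s where s: "d \<le> s" "s \<le> 1" "\<And>w. cmod (w - z) = s \<Longrightarrow> good w" using circle by blast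
    define b where "b = (d / (4 * R)) ^ card Z"
    have b: "b > 0" using dR by (simp add: b_def)
    have "cmod (GP z) \<le> P0 / b ^ 3"
    proof (rule norm_le_on_disc[of GP z s])
      show "cmod (GP w) \<le> P0 / b ^ 3" if "cmod (w - z) = s" for w
      proof -
        have g: "good w" using s that by blast
        have "b * b * b \<le> cmod (B 0 w) * cmod (B 1 w) * cmod (B 2 w)"
          using B_ge[OF g] b by (intro mult_mono) (auto simp: b_def)
        then have "b * b * b * cmod (GP w) \<le> cmod (B 0 w) * cmod (B 1 w) * cmod (B 2 w) * cmod (GP w)"
          by (intro mult_right_mono) auto
        also have "\<dots> = cmod (P w)" by (simp add: P_eq norm_mult)
        also have "\<dots> \<le> P0" using P0(2)[of w] that s by (simp add: P_def z_def)
        finally show ?thesis using b by (simp add: power3_eq_cube field_simps)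
      qed
    qed (use GP_hol s d in auto)
    moreover have "cmod (GP z) > 0"
      using G_nz[of _ t0 z] R ct[of t0] by (simp add: GP_def z_def)
    ultimately have "ln (cmod (GP z)) \<le> ln (P0 / b ^ 3)"
      using P0(1) b by (subst ln_le_cancel_iff) auto
    also have "\<dots> = ln P0 - 3 * (N * ln (d / (4 * R)))"
      using P0 b dR d R40 by (simp add: ln_div ln_realpow b_def N_def)
    also have "ln (d / (4 * R)) = - ln (4 * R / d)" using d R40 by (simp add: ln_div)
    finally show ?thesis by (simp add: z_def)
  qed
  have M_ge: "ln (cmod (GP (of_real R * e))) + X \<le> M"
  proof -
    have "ln (cmod (GP (of_real R * e))) + X \<le> 3 ^ k * (ln (cmod (GP (of_real t0 * e))) + X)"
      \<comment> \<open>The aperture is now c/2, hence the ratio 1 + c/4 in the assumption on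
        \<open>k\<close>.\<close>
      by (rule harnack_chain[of GP "c/2" t0 e R X R k]) (use GP_hol c t0' e R k GP_low in auto)
    also have "\<dots> \<le> M" unfolding M_def using base by (intro mult_left_mono) (auto simp: X_def)
    finally show ?thesis .
  qed
  have MX: "X \<le> M"
  proof -
    have "1 * X \<le> 3 ^ k * (ln P0 + 3 * N * ln (4 * R / d) + X)"
      using logP0 log4 N0 X0 by (intro mult_mono) auto
    then show ?thesis by (simp add: M_def X_def)
  qed
  define zR where "zR = of_real R * e"
  have cR: "c * R \<ge> 40" using ct R by simp
  \<comment> \<open>One more Harnack step, in a disc of radius c R/2 >= 20, covers distance 10; the
    radii 10, 9, 8 below leave room for good circles of radius at most 1.\<close>
  have GP_up: "cmod (GP z) \<le> exp (3 * M)" if "cmod (z - zR) \<le> 10" for z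
  proof -
    have zz: "cmod (z - zR) < c / 2 * R" using that cR by simp
    have "ln (cmod (GP z)) + X \<le> 3 * (ln (cmod (GP zR)) + X)"
    proof (rule harnack_zero_free[of GP zR "c / 2 * R"])
      show "exp (- X) \<le> cmod (GP w)" if "w \<in> ball zR (c / 2 * R)" for w
        using GP_low[of R w] that R by (simp add: zR_def dist_norm norm_minus_commute)
      show "cmod (z - zR) \<le> c / 2 * R / 2" using that cR by simp
    qed (use GP_hol cR in auto)
    then have "ln (cmod (GP z)) \<le> 3 * M" using M_ge X0 by (simp add: zR_def)
    moreover have "cmod (GP z) > 0"
      using GP_low[of R z] zz R by (smt (verit) exp_gt_zero zR_def)
    ultimately show ?thesis by (metis exp_le_cancel_iff exp_ln)
  qed
  define X' where "X' = 3 * M + X"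
  \<comment> \<open>The role of the third solution: |P| above and the product of the other two below
    bound each |f_j| above; a pairwise bound then bounds |f_i| below by m0^2 exp(-3M) =
    exp(-X').\<close>
  have f_low: "exp (- X') \<le> cmod (f i w)" if i: "i < 3" and w: "good w" "cmod (w - zR) \<le> 9" for i w
  proof -
    have wt: "cmod (w - of_real R * e) < c * R - 1" using w cR by (simp add: zR_def)
    note p = pair[OF R order.refl wt w(1)]
    have w2: "cmod w \<le> 2 * R" using region(2)[of R w] R wt by simp
    have P_up: "cmod (P w) \<le> exp (3 * M)"
      using P_le_GP[OF w2] GP_up[of w] w by simp
    have up: "cmod (f j w) \<le> exp (3 * M) / m0" if j: "j < 3" for j
    proof -
      obtain a b where ab: "a < 3" "b < 3" "a \<noteq> b" "P w = f j w * (f a w * f b w)"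
      proof -
        consider "j = 0" | "j = 1" | "j = 2" using j by linarith
        then show thesis
        proof cases
          case 1 then show ?thesis using that[of 1 2] by (simp add: P_def)
        next
          case 2 then show ?thesis using that[of 0 2] by (simp add: P_def)
        next
          case 3 then show ?thesis using that[of 0 1] by (simp add: P_def)
        qed
      qed
      have "cmod (f j w) * m0 \<le> cmod (f j w) * cmod (f a w * f b w)"
        using p[OF ab(1-3)] by (intro mult_left_mono) auto
      also have "\<dots> = cmod (P w)" by (simp add: ab(4) norm_mult)
      finally show ?thesis using P_up m0 by (simp add: field_simps)
    qed
    define j where "j = (if i = 0 then 1 else 0 :: nat)"
    have j: "j < 3" "i \<noteq> j" by (auto simp: j_def)
    have "m0 \<le> cmod (f i w) * cmod (f j w)" using p[OF i j] by (simp add: norm_mult)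
    also have "\<dots> \<le> cmod (f i w) * (exp (3 * M) / m0)" using up[OF j(1)] by (intro mult_left_mono) auto
    finally have "m0\<^sup>2 \<le> cmod (f i w) * exp (3 * M)" using m0 by (simp add: field_simps power2_eq_square)
    then have low: "m0\<^sup>2 * exp (- (3 * M)) \<le> cmod (f i w)" by (simp add: exp_minus field_simps)
    have "m0\<^sup>2 * exp (- (3 * M)) = exp (- X')"
      by (simp add: X'_def expX[symmetric] mult_exp_exp)
    then show ?thesis using low by simp
  qed
  have G_low: "exp (- X') \<le> cmod (G i z)" if i: "i < 3" and z: "cmod (z - zR) \<le> 8" for i z
  proof -
    obtain s where s: "d \<le> s" "s \<le> 1" "\<And>w. cmod (w - z) = s \<Longrightarrow> good w" using circle by blast
    have near: "cmod (w - zR) \<le> 9" if "cmod (w - z) \<le> s" for w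
      using norm_triangle_ineq[of "w - z" "z - zR"] that s z by simp
    have near': "cmod (w - of_real R * e) < c * R" if "cmod (w - z) \<le> s" for w
      using near[OF that] cR by (simp add: zR_def)
    show ?thesis
    proof (rule norm_ge_on_disc[of "G i" z s])
      show "G i w \<noteq> 0" if "w \<in> cball z s" for w
        using that near'[of w] by (intro G_nz[OF i R order.refl]) (simp add: dist_norm norm_minus_commute)
      show "exp (- X') \<le> cmod (G i w)" if "cmod (w - z) = s" for w
      proof -
        have "cmod w \<le> 2 * R" using region(2)[OF R order.refl near'[of w]] that by simp
        then have "cmod (B i w) * cmod (G i w) \<le> 1 * cmod (G i w)"
          using B_le by (intro mult_right_mono) auto
        then show ?thesis using f_low[OF i s(3)[OF that] near[of w]] that G(2)[OF i, of w] by (simp add: norm_mult)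
      qed
    qed (use G_cont i s d in auto)
  qed
  define Y where "Y = ln (cmod (G 0 zR)) + X'"
  \<comment> \<open>Subtracting the lower bounds for ln |G 1| and ln |G 2| from the upper bound for
    ln |GP| gives Y <= M - X + 3X' = 10M + 2X <= 12M.\<close>
  have Y_le: "Y \<le> 15 * M"
  proof -
    have pos: "cmod (G i zR) > 0" if "i < 3" for i
      using G_low[OF that, of zR] by (smt (verit) exp_gt_zero norm_zero diff_self)
    have lnG: "- X' \<le> ln (cmod (G i zR))" if "i < 3" for i
      using G_low[OF that, of zR] pos[OF that] by (simp add: ln_ge_iff)
    have "ln (cmod (GP zR)) = ln (cmod (G 0 zR)) + ln (cmod (G 1 zR)) + ln (cmod (G 2 zR))"
      using pos[of 0] pos[of 1] pos[of 2] by (simp add: GP_def norm_mult ln_mult)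
    then have "ln (cmod (G 0 zR)) \<le> M - X + 2 * X'"
      using M_ge lnG[of 1] lnG[of 2] by (simp add: zR_def)
    then show ?thesis using MX X0 by (simp add: Y_def X'_def)
  qed
  have M0: "M \<ge> 0" using MX X0 by simp
  \<comment> \<open>Radius 8 turns both derivative bounds into plain \<open>Y\<close>, on a disc of
    radius 2.\<close>
  obtain g where g: "g holomorphic_on ball zR 8" "\<And>z. z \<in> ball zR 8 \<Longrightarrow> G 0 z = exp (g z)"
    "\<And>z. cmod (z - zR) \<le> 8 / 4 \<Longrightarrow> cmod (deriv g z) \<le> 8 * Y / 8"
    "\<And>z. cmod (z - zR) \<le> 8 / 4 \<Longrightarrow> cmod (deriv (deriv g) z) \<le> 64 * Y / 8\<^sup>2"
  proof (rule zero_free_log_deriv_bounds[of "G 0" zR 8 X'])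
    show "exp (- X') \<le> cmod (G 0 z)" if "z \<in> ball zR 8" for z
      using that by (intro G_low) (auto simp: dist_norm norm_minus_commute)
  qed (use G_cont in \<open>auto simp: Y_def\<close>)
  \<comment> \<open>The second distance: it depends on \<open>N\<close> alone, because its
    reciprocal enters the Riccati bound polynomially. By pigeonhole the circle radius is still at
    most 1.\<close>
  define d' where "d' = 1 / (2 * N + 1)"
  have d': "d' > 0" using N0 by (simp add: d'_def)
  obtain s where s: "d' \<le> s" "s \<le> (2 * real (card (Zi 0)) + 1) * d'"
    "\<And>w a. cmod (w - zR) = s \<Longrightarrow> a \<in> Zi 0 \<Longrightarrow> d' \<le> cmod (w - a)"
    using circle_avoiding_finite_set[OF Zi(1)[of 0] d', of zR] by metis
  have cardN: "real (card (Zi 0)) \<le> N" using Zi(2) by (simp add: N_def)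
  have s1: "s \<le> 1"
  proof -
    have "s \<le> (2 * N + 1) * d'" using s(2) cardN d' by (smt (verit) mult_right_mono)
    then show ?thesis using N0 by (simp add: d'_def)
  qed
  define T where "T = 15 * M + (2 * N + 1) ^ 3"
  have "cmod (A zR) \<le> 2 * T\<^sup>2"
  proof (rule norm_le_on_disc[of A zR s])
    show "cmod (A w) \<le> 2 * T\<^sup>2" if w: "cmod (w - zR) = s" for w
    proof -
      have w8: "w \<in> ball zR 8" using w s1 by (simp add: dist_norm norm_minus_commute)
      have "cmod (A w) \<le> 15 * M + real (card (Zi 0)) / d'\<^sup>2 + (15 * M + real (card (Zi 0)) / d')\<^sup>2"
      proof (rule norm_coefficient_le[of A "f 0" "Zi 0" "of_real (4 * R)" g "ball zR 8"])
        show "f 0 z = (\<Prod>a\<in>Zi 0. (z - a) / of_real (4 * R)) * exp (g z)" if "z \<in> ball zR 8" for z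
          using G(2)[of 0 z] g(2)[OF that] by (simp add: B_def)
        show "cmod (deriv g w) \<le> 15 * M" "cmod (deriv (deriv g) w) \<le> 15 * M"
          using g(3,4)[of w] w s1 Y_le by auto
      qed (use sol Zi R40 g(1) w8 d' s(3)[OF w] in auto)
      also have "\<dots> \<le> T + T\<^sup>2"
      proof (intro add_mono power_mono)
        define q where "q = 2 * N + 1"
        have q: "q \<ge> 1" "N \<le> q" "d' = 1 / q" using N0 by (auto simp: q_def d'_def)
        have "real (card (Zi 0)) / d'\<^sup>2 = real (card (Zi 0)) * q\<^sup>2" using q by (simp add: power_divide)
        also have "\<dots> \<le> q * q\<^sup>2" using cardN q by (intro mult_right_mono) auto
        finally show "15 * M + real (card (Zi 0)) / d'\<^sup>2 \<le> T"
          by (simp add: T_def q_def[symmetric] power2_eq_square power3_eq_cube mult.assoc)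
        have "real (card (Zi 0)) / d' = real (card (Zi 0)) * q" using q by simp
        also have "\<dots> \<le> q * q\<^sup>2" using cardN q self_le_power[of q 2] by (intro mult_mono) auto
        finally show "15 * M + real (card (Zi 0)) / d' \<le> T"
          by (simp add: T_def q_def[symmetric] power2_eq_square power3_eq_cube mult.assoc)
        show "0 \<le> 15 * M + real (card (Zi 0)) / d'" using M0 d' by simp
      qed
      also have "\<dots> \<le> 2 * T\<^sup>2"
      proof -
        have "1 \<le> (2 * N + 1) ^ 3" using N0 by (simp add: one_le_power)
        then have "T \<ge> 1" using M0 by (simp add: T_def)
        then show ?thesis using self_le_power[of T 2] by simp
      qed
      finally show ?thesis .
    qed
  qed (use A s d' in \<open>auto intro: holomorphic_on_subset\<close>)
  then show ?thesis by (simp add: zR_def T_def)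
qed

text \<open>The condition log^+ |u(R)| = o(R^n) in quantifier form. It is closed under sums,
  products and powers, so a composite bound can be checked piece by piece.\<close>

definition subexponential :: "nat \<Rightarrow> (real \<Rightarrow> real) \<Rightarrow> bool" where
  "subexponential n u \<longleftrightarrow> (\<forall>\<delta>>0. eventually (\<lambda>R. \<bar>u R\<bar> \<le> exp (\<delta> * R ^ n)) at_top)"

lemma subexponential_mono:
  assumes "subexponential n v" "eventually (\<lambda>R. \<bar>u R\<bar> \<le> \<bar>v R\<bar>) at_top"
  shows "subexponential n u"
  unfolding subexponential_def
proof (intro allI impI)
  fix \<delta> :: real assume "\<delta> > 0"
  then have "eventually (\<lambda>R. \<bar>v R\<bar> \<le> exp (\<delta> * R ^ n)) at_top" using assms(1) by (simp add: subexponential_def)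
  then show "eventually (\<lambda>R. \<bar>u R\<bar> \<le> exp (\<delta> * R ^ n)) at_top"
    using assms(2) by eventually_elim simp
qed

lemma subexponential_mult:
  assumes "subexponential n u" "subexponential n v"
  shows "subexponential n (\<lambda>R. u R * v R)"
  unfolding subexponential_def
proof (intro allI impI)
  fix \<delta> :: real assume "\<delta> > 0"
  then have "eventually (\<lambda>R. \<bar>u R\<bar> \<le> exp (\<delta>/2 * R ^ n)) at_top" "eventually (\<lambda>R. \<bar>v R\<bar> \<le> exp (\<delta>/2 * R ^ n)) at_top"
    using assms by (simp_all add: subexponential_def del: times_divide_eq_left)
  then show "eventually (\<lambda>R. \<bar>u R * v R\<bar> \<le> exp (\<delta> * R ^ n)) at_top"
  proof eventually_elim
    case (elim R)
    have "\<bar>u R * v R\<bar> \<le> exp (\<delta>/2 * R ^ n) * exp (\<delta>/2 * R ^ n)"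
      unfolding abs_mult using elim by (intro mult_mono) auto
    then show ?case by (simp add: mult_exp_exp)
  qed
qed

lemma subexponential_const:
  assumes "n \<ge> 1"
  shows "subexponential n (\<lambda>_. c)"
  unfolding subexponential_def
proof (intro allI impI)
  fix \<delta> :: real assume "\<delta> > 0"
  then have "eventually (\<lambda>R. \<bar>c\<bar> \<le> exp (\<delta> * R)) at_top" by real_asymp
  then show "eventually (\<lambda>R. \<bar>c\<bar> \<le> exp (\<delta> * R ^ n)) at_top"
    using eventually_ge_at_top[of 1]
  proof eventually_elim
    case (elim R)
    then have "\<delta> * R \<le> \<delta> * R ^ n" using \<open>\<delta> > 0\<close> assms by (intro mult_left_mono self_le_power) auto
    then show ?case using elim by (meson exp_le_cancel_iff order.trans)
  qed
qed

lemma subexponential_add: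
  assumes "subexponential n u" "subexponential n v" "n \<ge> 1"
  shows "subexponential n (\<lambda>R. u R + v R)"
proof -
  have "subexponential n (\<lambda>R. 2 * max \<bar>u R\<bar> \<bar>v R\<bar>)"
  proof (rule subexponential_mult[OF subexponential_const[OF assms(3)]])
    show "subexponential n (\<lambda>R. max \<bar>u R\<bar> \<bar>v R\<bar>)"
      unfolding subexponential_def
    proof (intro allI impI)
      fix \<delta> :: real assume "\<delta> > 0"
      then have "eventually (\<lambda>R. \<bar>u R\<bar> \<le> exp (\<delta> * R ^ n)) at_top" "eventually (\<lambda>R. \<bar>v R\<bar> \<le> exp (\<delta> * R ^ n)) at_top"
        using assms by (simp_all add: subexponential_def)
      then show "eventually (\<lambda>R. \<bar>max \<bar>u R\<bar> \<bar>v R\<bar>\<bar> \<le> exp (\<delta> * R ^ n)) at_top"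
        by eventually_elim simp
    qed
  qed
  then show ?thesis by (rule subexponential_mono) (intro always_eventually allI, simp)
qed

lemma subexponential_power:
  assumes "subexponential n u" "n \<ge> 1"
  shows "subexponential n (\<lambda>R. u R ^ k)"
  by (induction k) (auto intro: subexponential_const subexponential_mult assms)

lemma subexponential_powr:
  assumes "n \<ge> 1"
  shows "subexponential n (\<lambda>R. R powr q)"
  unfolding subexponential_def
proof (intro allI impI)
  fix \<delta> :: real assume "\<delta> > 0"
  then have "eventually (\<lambda>R. R powr q \<le> exp (\<delta> * R)) at_top" by real_asymp
  then show "eventually (\<lambda>R. \<bar>R powr q\<bar> \<le> exp (\<delta> * R ^ n)) at_top"
    using eventually_ge_at_top[of 1]
  proof eventually_elim
    case (elim R)
    then have "\<delta> * R \<le> \<delta> * R ^ n" using \<open>\<delta> > 0\<close> assms by (intro mult_left_mono self_le_power) auto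
    then have "exp (\<delta> * R) \<le> exp (\<delta> * R ^ n)" by simp
    with elim(1) have "R powr q \<le> exp (\<delta> * R ^ n)" by (rule order.trans)
    then show ?case by simp
  qed
qed

lemma subexponential_exp_powr:
  assumes "\<tau> < real n"
  shows "subexponential n (\<lambda>R. exp ((2 * R) powr \<tau>))"
  unfolding subexponential_def
proof (intro allI impI)
  fix \<delta> :: real assume "\<delta> > 0"
  define p where "p = real n"
  have "eventually (\<lambda>R. (2 * R) powr \<tau> \<le> \<delta> * R powr p) at_top"
    using \<open>\<delta> > 0\<close> assms unfolding p_def[symmetric] by real_asymp
  then show "eventually (\<lambda>R. \<bar>exp ((2 * R) powr \<tau>)\<bar> \<le> exp (\<delta> * R ^ n)) at_top"
    using eventually_gt_at_top[of 0]
    by eventually_elim (simp add: p_def powr_realpow)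
qed

text \<open>The crude bound K = exp((3R)^p), with p above the order, may far exceed exp(R^n): it
  enters the estimate only through ln K. The zero counts carry the exponent \<open>\<tau>\<close> <
  n, and they alone contribute exponentially.\<close>

lemma ray_eventually_small:
  fixes f :: "nat \<Rightarrow> complex \<Rightarrow> complex"
  assumes A: "A holomorphic_on UNIV" and ord: "growth_order A < ereal p" and n: "n \<ge> 1"
    and sol: "\<And>i. i < 3 \<Longrightarrow> ode_solution A (f i)"
    and wr: "\<And>i j z. i < 3 \<Longrightarrow> j < 3 \<Longrightarrow> i \<noteq> j \<Longrightarrow> w0 \<le> cmod (f i z * deriv (f j) z - deriv (f i) z * f j z)"
    and w0: "0 < w0" "w0 \<le> 1" and \<epsilon>: "\<epsilon> > 0"
    and hyp: "\<And>i. i < 3 \<Longrightarrow> hyper_exponent (sector \<theta> \<epsilon>) (f i) < ereal \<tau>" and \<tau>: "\<tau> < real n" "\<tau> \<le> p" and p: "0 \<le> p"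
    and \<kappa>: "\<kappa> > 0"
  shows "eventually (\<lambda>R. cmod (A (of_real R * cis \<theta>)) < exp (\<kappa> * R ^ n)) at_top"
proof -
  define S where "S = sector \<theta> \<epsilon>"
  have cont: "continuous_on UNIV A" using A by (rule holomorphic_on_imp_continuous_on)
  obtain c where c: "0 < c" "c \<le> 1" "\<And>t z. t > 0 \<Longrightarrow> cmod (z - of_real t * cis \<theta>) < c * t \<Longrightarrow> z \<in> S"
    unfolding S_def using ball_subset_sector[OF \<epsilon>, of \<theta>] by blast
  define t0 where "t0 = 40 / c"
  have t0: "t0 \<ge> 40" "c * t0 = 40" using c by (auto simp: t0_def field_simps)
  \<comment> \<open>The exponent in 3^k <= 3 R^q, for k about log R to the base 1 + c/4.\<close>
  define q where "q = ln 3 / ln (1 + c/4)"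
  have f_cont: "continuous_on UNIV (f i)" if "i < 3" for i
    using sol[OF that] by (auto simp: ode_solution_def intro: holomorphic_on_imp_continuous_on)
  obtain P0 where P0: "P0 \<ge> 1" "\<And>z. cmod (z - of_real t0 * cis \<theta>) \<le> 1 \<Longrightarrow> cmod (f 0 z * f 1 z * f 2 z) \<le> P0"
  proof -
    have "compact ((\<lambda>z. f 0 z * f 1 z * f 2 z) ` cball (of_real t0 * cis \<theta>) 1)"
      by (intro compact_continuous_image continuous_intros continuous_on_subset[OF f_cont]) auto
    then have "bounded ((\<lambda>z. f 0 z * f 1 z * f 2 z) ` cball (of_real t0 * cis \<theta>) 1)" by (rule compact_imp_bounded)
    then obtain b where b: "\<And>z. z \<in> cball (of_real t0 * cis \<theta>) 1 \<Longrightarrow> cmod (f 0 z * f 1 z * f 2 z) \<le> b"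
      unfolding bounded_iff by blast
    show thesis
    proof (rule that[of "max 1 b"])
      show "cmod (f 0 z * f 1 z * f 2 z) \<le> max 1 b" if "cmod (z - of_real t0 * cis \<theta>) \<le> 1" for z
        using b[of z] that by (simp add: dist_norm norm_minus_commute le_max_iff_disj)
    qed simp
  qed
  define E where "E = (\<lambda>R::real. exp ((2 * R) powr \<tau>))"
  \<comment> \<open>The bound of \<open>ray_estimate\<close> with N replaced by 3E, 3^k by 3R^q, and
    the logarithms by powers of R plus constants.\<close>
  define F where "F = (\<lambda>R. 2 * (15 * (3 * R powr q * (ln P0 + 9 * E R * (64 * R powr 1 + 3 powr p * R powr p)
      + 2 * (ln (64 / w0) + 3 powr p * R powr p))) + (6 * E R + 1) ^ 3)\<^sup>2)"
  have "subexponential n F"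
    unfolding F_def E_def using n \<tau>
    by (intro subexponential_mult subexponential_add subexponential_const subexponential_power
        subexponential_powr subexponential_exp_powr) auto
  then have F_small: "eventually (\<lambda>R. \<bar>F R\<bar> \<le> exp (\<kappa>/2 * R ^ n)) at_top"
    using \<kappa> unfolding subexponential_def by (meson half_gt_zero)
  have ev2: "filterlim (\<lambda>R::real. 2 * R) at_top at_top" "filterlim (\<lambda>R::real. 3 * R) at_top at_top"
    by real_asymp+
  have zc: "eventually (\<lambda>R. real (zero_count S (f i) (2 * R)) \<le> E R) at_top" if "i < 3" for i
    unfolding E_def S_def by (rule eventually_compose_filterlim[OF hyper_exponent_bound[OF hyp[OF that]] ev2(1)])
  have "eventually (\<lambda>R. \<forall>i\<in>{..<3}. real (zero_count S (f i) (2 * R)) \<le> E R) at_top"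
    by (rule eventually_ball_finite) (auto intro: zc)
  moreover have "eventually (\<lambda>R. \<forall>z. cmod z \<le> 3 * R \<longrightarrow> cmod (A z) \<le> exp ((3 * R) powr p)) at_top"
    by (rule eventually_compose_filterlim[OF growth_order_bound[OF A ord] ev2(2)])
  ultimately show ?thesis
    using F_small eventually_ge_at_top[of t0]
  proof eventually_elim
    case (elim R)
    have R: "R \<ge> t0" "R \<ge> 40" using elim t0 by auto
    define K where "K = exp ((3 * R) powr p)"
    \<comment> \<open>Taking 1/(16K) and not 1/(4 sqrt K) meets two demands at once: K d^2 <= 1/16,
      and (2N+1) d <= 1, because N <= 3E <= 3K.\<close>
    define d where "d = 1 / (16 * K)"
    have K1: "K \<ge> 1" by (simp add: K_def)
    have d: "d > 0" "d \<le> 1" using K1 by (auto simp: d_def)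
    have Kd: "K * d\<^sup>2 \<le> 1/16" using K1 by (simp add: d_def power2_eq_square field_simps)
    have AK: "cmod (A z) \<le> K" if "cmod z \<le> 3 * R" for z using elim that by (simp add: K_def)
    have nz: "\<exists>z0. f i z0 \<noteq> 0" if "i < 3" for i
    proof (rule ccontr)
      assume *: "\<nexists>z0. f i z0 \<noteq> 0"
      then have fi: "f i = (\<lambda>_. 0)" by auto
      define j where "j = (if i = 0 then 1 else 0 :: nat)"
      have "j < 3" "i \<noteq> j" by (auto simp: j_def)
      from wr[OF that this, of 0] show False using w0 by (simp add: fi)
    qed
    define Zi where "Zi = (\<lambda>i. {z \<in> S. cmod z \<le> 2 * R \<and> f i z = 0})"
    have Zi: "finite (Zi i)" "real (card (Zi i)) \<le> E R" if i: "i < 3" for i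
    proof -
      obtain z0 where z0: "f i z0 \<noteq> 0" using nz[OF i] by blast
      have "finite {z. cmod z \<le> 2 * R \<and> f i z = 0}"
        by (rule card_solution_zeros_le(1)[OF sol[OF i] cont z0 _ Kd]) (use AK R d in auto)
      then show "finite (Zi i)" by (rule rev_finite_subset) (auto simp: Zi_def)
      have zeq: "zero_count S (f i) (2 * R) = card (Zi i)"
        unfolding Zi_def by (rule zero_count_solution[OF sol[OF i] cont z0])
      have "real (zero_count S (f i) (2 * R)) \<le> E R" using elim(1) i by blast
      then show "real (card (Zi i)) \<le> E R" by (simp only: zeq)
    qed
    define Z where "Z = {z \<in> S. cmod z \<le> 2 * R \<and> (\<exists>i<3. f i z = 0)}"
    have Z_eq: "Z = Zi 0 \<union> Zi 1 \<union> Zi 2"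
      by (auto simp: Z_def Zi_def numeral_3_eq_3 less_Suc_eq numeral_2_eq_2)
    have finZ: "finite Z" using Zi(1) by (simp add: Z_eq)
    define N where "N = real (card Z)"
    have N0: "N \<ge> 0" by (simp add: N_def)
    have N: "N \<le> 3 * E R"
    proof -
      have "card Z \<le> card (Zi 0) + card (Zi 1) + card (Zi 2)"
        unfolding Z_eq using card_Un_le[of "Zi 0 \<union> Zi 1" "Zi 2"] card_Un_le[of "Zi 0" "Zi 1"] by linarith
      then have "N \<le> real (card (Zi 0)) + real (card (Zi 1)) + real (card (Zi 2))" by (simp add: N_def)
      then show ?thesis using Zi(2)[of 0] Zi(2)[of 1] Zi(2)[of 2] by simp
    qed
    have E1: "E R \<ge> 1" by (simp add: E_def)
    have EK: "E R \<le> K"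
    proof -
      have "(2 * R) powr \<tau> \<le> (2 * R) powr p" using R \<tau> by (intro powr_mono) auto
      also have "\<dots> \<le> (3 * R) powr p"
        using R p by (intro powr_mono2) auto
      finally show ?thesis by (simp add: E_def K_def)
    qed
    have Nd: "(2 * N + 1) * d \<le> 1"
      using N E1 EK K1 by (simp add: d_def divide_le_eq)
    define k where "k = nat \<lceil>log (1 + c/4) (R / t0)\<rceil>"
    have b: "1 + c/4 > 1" using c by simp
    have k1: "R \<le> t0 * (1 + c/4) ^ k"
    proof -
      have "log (1 + c/4) (R / t0) \<le> real k" unfolding k_def by linarith
      then have "R / t0 \<le> (1 + c/4) powr real k" using b R t0 by (simp add: log_le_iff)
      then show ?thesis using t0 b by (simp add: powr_realpow field_simps)
    qed
    have k2: "3 ^ k \<le> 3 * R powr q"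
    proof -
      have "log (1 + c/4) (R / t0) \<ge> 0" using b R t0 by simp
      then have "real k \<le> log (1 + c/4) (R / t0) + 1" unfolding k_def by linarith
      also have "\<dots> \<le> log (1 + c/4) R + 1" using b R t0 by (simp add: divide_le_eq)
      finally have "3 powr real k \<le> 3 powr (log (1 + c/4) R + 1)" by simp
      also have "\<dots> = 3 * 3 powr log (1 + c/4) R" by (simp add: powr_add)
      also have "3 powr log (1 + c/4) R = R powr q" using R by (simp add: powr_def log_def q_def)
      finally show ?thesis by (simp add: powr_realpow)
    qed
    define M where "M = 3 ^ k * (ln P0 + 3 * N * ln (4 * R / d) + 2 * ln (4 / (w0 * d)))"
    define V where "V = 3 powr p * R powr p"
    have lnK: "ln K = V" using R by (simp add: K_def V_def powr_mult)
    have V0: "V \<ge> 0" by (simp add: V_def)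
    have l1: "ln (4 * R / d) \<le> 64 * R powr 1 + V"
    proof -
      have "ln (4 * R / d) = ln (64 * R) + V" using R K1 by (simp add: d_def ln_mult lnK[symmetric])
      also have "ln (64 * R) \<le> 64 * R" by (rule less_imp_le, rule ln_less_self) (use R in simp)
      finally show ?thesis using R by simp
    qed
    have l1': "ln (4 * R / d) \<ge> 0" using R d by simp
    have l2: "ln (4 / (w0 * d)) = ln (64 / w0) + V"
      using w0 K1 by (simp add: d_def ln_mult ln_div lnK[symmetric])
    have l2': "ln (64 / w0) \<ge> 0" using w0 by simp
    have M0: "M \<ge> 0" using P0 N0 l1' l2 l2' V0 by (simp add: M_def)
    have M_le: "M \<le> 3 * R powr q * (ln P0 + 9 * E R * (64 * R powr 1 + V) + 2 * (ln (64 / w0) + V))"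
      unfolding M_def
    proof (rule mult_mono[OF k2])
      have "3 * N * ln (4 * R / d) \<le> 9 * E R * (64 * R powr 1 + V)"
        by (rule mult_mono) (use N N0 E1 l1 l1' in auto)
      then show "ln P0 + 3 * N * ln (4 * R / d) + 2 * ln (4 / (w0 * d))
          \<le> ln P0 + 9 * E R * (64 * R powr 1 + V) + 2 * (ln (64 / w0) + V)"
        by (simp add: l2)
    qed (use P0 N0 l1' l2 l2' V0 in auto)
    have "cmod (A (of_real R * cis \<theta>)) \<le> 2 * (15 * M + (2 * N + 1) ^ 3)\<^sup>2"
      unfolding M_def N_def
    proof (rule ray_estimate[of A f w0 "cis \<theta>" c t0 R S Z K d P0 k])
      show "z \<in> S" if "t0 \<le> t" "cmod (z - of_real t * cis \<theta>) < c * t" for t z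
        using c(3)[of t z] that t0 by simp
      show "(2 * real (card Z) + 1) * d \<le> 1" using Nd by (simp add: N_def)
    qed (use A sol wr w0 c t0 R Z_def finZ AK d Kd P0 k1 in auto)
    also have "\<dots> \<le> F R"
      unfolding F_def V_def[symmetric] using M_le M0 N N0
      by (intro mult_left_mono power_mono add_mono) auto
    also have "\<dots> \<le> exp (\<kappa>/2 * R ^ n)" using elim by linarith
    also have "\<dots> < exp (\<kappa> * R ^ n)" using \<kappa> R by simp
    finally show ?case .
  qed
qed

section \<open>The three-solution theorem\<close>

theorem theorem14:
  fixes A f1 f2 f3 :: "complex \<Rightarrow> complex" and n :: nat and \<theta>s \<epsilon> :: real
  assumes "exponential_polynomial A"
    and "growth_order A = ereal (real n)" and "n \<ge> 1"
    and "\<forall>\<theta>. PL_indicator n A \<theta> \<le> PL_indicator n A \<theta>s"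
    and "0 < \<epsilon>" and "\<epsilon> < pi / (2 * real n)"
    and "solution_base A f1 f2"
    and "\<exists>a b :: complex. f3 = (\<lambda>z. a * f1 z + b * f2 z)"
    and "\<not> (\<exists>c :: complex. f3 = (\<lambda>z. c * f1 z) \<or> f3 = (\<lambda>z. c * f2 z))"
  shows "Max {hyper_exponent (sector \<theta>s \<epsilon>) f1, hyper_exponent (sector \<theta>s \<epsilon>) f2,
              hyper_exponent (sector \<theta>s \<epsilon>) f3} = ereal (real n)"
proof -
  have A: "A holomorphic_on UNIV" using assms(1) by (rule exponential_polynomial_holomorphic)
  have cont: "continuous_on UNIV A" using A by (rule holomorphic_on_imp_continuous_on)
  have s1: "ode_solution A f1" and s2: "ode_solution A f2" and ind: "lin_indep_pair f1 f2"
    using assms(7) by (auto simp: solution_base_def)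
  obtain a b where f3: "f3 = (\<lambda>z. a * f1 z + b * f2 z)" using assms(8) by blast
  have ab: "a \<noteq> 0" "b \<noteq> 0" using assms(9) f3 by auto
  have df3: "deriv f3 z = a * deriv f1 z + b * deriv f2 z" for z
    unfolding f3 by (intro DERIV_imp_deriv DERIV_add DERIV_cmult solution_derivs[OF s1] solution_derivs[OF s2])
  have ddf3: "deriv (deriv f3) z = - A z * f3 z" for z
  proof -
    have "deriv f3 = (\<lambda>z. a * deriv f1 z + b * deriv f2 z)" using df3 by auto
    then have "(deriv f3 has_field_derivative a * (- A z * f1 z) + b * (- A z * f2 z)) (at z)"
      by (simp only:) (intro DERIV_add DERIV_cmult solution_derivs(2)[OF s1] solution_derivs(2)[OF s2])
    then show ?thesis by (simp add: DERIV_imp_deriv f3 algebra_simps)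
  qed
  have s3: "ode_solution A f3"
    unfolding ode_solution_def
  proof
    show "f3 holomorphic_on UNIV"
      using s1 s2 unfolding f3 ode_solution_def by (auto intro!: holomorphic_intros)
    show "\<forall>z. deriv (deriv f3) z + A z * f3 z = 0" by (simp add: ddf3)
  qed
  define W where "W = f1 0 * deriv f2 0 - deriv f1 0 * f2 0"
  have W12: "f1 z * deriv f2 z - deriv f1 z * f2 z = W" for z
    unfolding W_def by (rule wronskian_constant[OF s1 s2])
  have W: "W \<noteq> 0"
  proof
    assume W0: "W = 0"
    \<comment> \<open>If W = 0, the initial data of \<open>f1\<close> and \<open>f2\<close> are
      linearly dependent. The null vector is (f2 0, -f1 0), or, if both values vanish, one read off
      from the derivatives.\<close>
    have "\<exists>p q. (p \<noteq> 0 \<or> q \<noteq> 0) \<and> p * f1 0 + q * f2 0 = 0 \<and> p * deriv f1 0 + q * deriv f2 0 = 0"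
    proof (cases "f1 0 = 0 \<and> f2 0 = 0")
      case True
      show ?thesis
      proof (cases "deriv f1 0 = 0")
        case True
        then show ?thesis using \<open>f1 0 = 0 \<and> f2 0 = 0\<close> by (intro exI[of _ 1] exI[of _ 0]) auto
      next
        case False
        then show ?thesis using \<open>f1 0 = 0 \<and> f2 0 = 0\<close>
          by (intro exI[of _ "deriv f2 0"] exI[of _ "- deriv f1 0"]) auto
      qed
    next
      case False
      then show ?thesis using W0
        by (intro exI[of _ "f2 0"] exI[of _ "- f1 0"]) (auto simp: W_def algebra_simps)
    qed
    then obtain p q where pq: "p \<noteq> 0 \<or> q \<noteq> 0" "p * f1 0 + q * f2 0 = 0" "p * deriv f1 0 + q * deriv f2 0 = 0"
      by blast
    define g where "g = (\<lambda>z. p * f1 z + q * f2 z)"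
    have dg: "deriv g = (\<lambda>z. p * deriv f1 z + q * deriv f2 z)"
      unfolding g_def by (intro ext DERIV_imp_deriv DERIV_add DERIV_cmult solution_derivs[OF s1] solution_derivs[OF s2])
    have "deriv (deriv g) z = p * (- A z * f1 z) + q * (- A z * f2 z)" for z
      unfolding dg by (intro DERIV_imp_deriv DERIV_add DERIV_cmult solution_derivs(2)[OF s1] solution_derivs(2)[OF s2])
    then have "ode_solution A g"
      using s1 s2 unfolding ode_solution_def by (auto simp: g_def algebra_simps intro!: holomorphic_intros)
    then have "g z = 0" for z
      using solution_zero_data_imp_zero[of A g 0 z] cont pq by (simp add: g_def dg[unfolded g_def])
    then show False using ind pq(1) unfolding lin_indep_pair_def g_def by blast
  qed
  have W13: "f1 z * deriv f3 z - deriv f1 z * f3 z = b * W" for z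
    unfolding W12[of z, symmetric] df3 by (simp add: f3 algebra_simps)
  have W23: "f2 z * deriv f3 z - deriv f2 z * f3 z = - a * W" for z
    unfolding W12[of z, symmetric] df3 by (simp add: f3 algebra_simps)
  have nz: "\<exists>z. f1 z \<noteq> 0" "\<exists>z. f2 z \<noteq> 0" "\<exists>z. f3 z \<noteq> 0"
  proof -
    have zero: "g 0 = 0 \<and> deriv g 0 = 0" if "\<not> (\<exists>z. g z \<noteq> 0)" for g :: "complex \<Rightarrow> complex"
    proof -
      have "g = (\<lambda>_. 0)" using that by auto
      then show ?thesis by simp
    qed
    show "\<exists>z. f1 z \<noteq> 0" using zero[of f1] W12[of 0] W by fastforce
    show "\<exists>z. f2 z \<noteq> 0" using zero[of f2] W12[of 0] W by fastforce
    show "\<exists>z. f3 z \<noteq> 0" using zero[of f3] W13[of 0] W ab by fastforce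
  qed
  have upper: "hyper_exponent (sector \<theta>s \<epsilon>) g \<le> ereal (real n)" if "ode_solution A g" "\<exists>z. g z \<noteq> 0" for g
    using that hyper_exponent_le[OF that(1) A _ assms(2)] by auto
  define m where "m = Max {hyper_exponent (sector \<theta>s \<epsilon>) f1, hyper_exponent (sector \<theta>s \<epsilon>) f2,
              hyper_exponent (sector \<theta>s \<epsilon>) f3}"
  have "m \<le> ereal (real n)"
    unfolding m_def using upper[OF s1 nz(1)] upper[OF s2 nz(2)] upper[OF s3 nz(3)] by simp
  moreover have "\<not> m < ereal (real n)"
  proof
    assume "m < ereal (real n)"
    then obtain \<tau> where \<tau>: "m < ereal \<tau>" "ereal \<tau> < ereal (real n)" using ereal_dense2 by blast
    define f where "f = (\<lambda>i::nat. if i = 0 then f1 else if i = 1 then f2 else f3)"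
    \<comment> \<open>The pairwise Wronskians have moduli |W|, |bW| and |aW|, all nonzero since f3
      is a multiple of neither f1 nor f2; the cap at 1 is required by
      \<open>ray_estimate\<close>.\<close>
    define w0 where "w0 = min 1 (cmod W * min 1 (min (cmod a) (cmod b)))"
    have w0: "0 < w0" "w0 \<le> 1" using W ab by (auto simp: w0_def)
    have w0_le: "w0 \<le> cmod W" "w0 \<le> cmod (b * W)" "w0 \<le> cmod (- a * W)"
    proof -
      have "cmod W * min 1 (min (cmod a) (cmod b)) \<le> cmod W * 1"
        "cmod W * min 1 (min (cmod a) (cmod b)) \<le> cmod W * cmod b"
        "cmod W * min 1 (min (cmod a) (cmod b)) \<le> cmod W * cmod a"
        by (intro mult_left_mono; simp)+
      then show "w0 \<le> cmod W" "w0 \<le> cmod (b * W)" "w0 \<le> cmod (- a * W)"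
        by (auto simp: w0_def norm_mult mult.commute)
    qed
    have wr: "w0 \<le> cmod (f i z * deriv (f j) z - deriv (f i) z * f j z)" if ij: "i < 3" "j < 3" "i \<noteq> j" for i j z
    proof -
      have sym: "cmod (x * y' - x' * y) = cmod (y * x' - y' * x)" for x y x' y' :: complex
        by (metis mult.commute norm_minus_commute)
      consider "i = 0 \<and> j = 1" | "i = 0 \<and> j = 2" | "i = 1 \<and> j = 2" | "i = 1 \<and> j = 0" | "i = 2 \<and> j = 0" | "i = 2 \<and> j = 1"
        using ij by linarith
      then show ?thesis
        using w0_le W12[of z] W13[of z] W23[of z] by cases (simp_all add: f_def sym[of "f2 z" "deriv f1 z"] sym[of "f3 z"])
    qed
    obtain \<theta> \<kappa> where \<kappa>: "\<kappa> > 0" "eventually (\<lambda>r. exp (\<kappa> * r ^ n) \<le> cmod (A (of_real r * cis \<theta>))) at_top"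
      using exponential_polynomial_large_on_ray[OF assms(1-3)] by blast
    \<comment> \<open>Halving produces the strict inequality that
      \<open>PL_indicator_frequently_large\<close> asks for.\<close>
    have "ereal (\<kappa>/2) < ereal \<kappa>" using \<kappa> by simp
    also have "\<dots> \<le> PL_indicator n A \<theta>" using PL_indicator_ge \<kappa>(2) by blast
    also have "\<dots> \<le> PL_indicator n A \<theta>s" using assms(4) by blast
    finally have "frequently (\<lambda>r. exp (\<kappa>/2 * r ^ n) \<le> cmod (A (of_real r * cis \<theta>s))) at_top"
      by (rule PL_indicator_frequently_large)
    moreover have "eventually (\<lambda>R. cmod (A (of_real R * cis \<theta>s)) < exp (\<kappa>/2 * R ^ n)) at_top"
    \<comment> \<open>\<open>real n + 1\<close> serves as a number strictly above the order of
      \<open>A\<close>.\<close>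
    proof (rule ray_eventually_small[of A "real n + 1" n f w0 \<epsilon> \<theta>s \<tau>])
      show "hyper_exponent (sector \<theta>s \<epsilon>) (f i) < ereal \<tau>" if "i < 3" for i
        using \<tau>(1) by (auto simp: f_def m_def)
      show "ode_solution A (f i)" for i using s1 s2 s3 by (simp add: f_def)
    qed (use A assms wr w0 \<tau> \<kappa> in auto)
    ultimately show False by (simp add: frequently_def not_le)
  qed
  ultimately have "m = ereal (real n)" by order
  then show ?thesis by (simp add: m_def)
qed

end
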